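(* Consider a sequence of sparse linear regression problems $y = X\beta^* + w$ indexed by the dimension $p$, satisfying the standing assumptions in the context, with $\rho_{2k}>0$ and $\rho_{k,1}>0$. Let SWAP be initialized with a support $S^{(1)}\subset[p]$ such that $|S^{(1)}| = k$ and $|S^*\setminus S^{(1)}| > 1$, and let $\widehat S$ be the output of SWAP. Suppose that for a constant $c$ with $0 < c^2 < 1/(18\sigma^2)$, $$ g(\gamma_k,\rho_{k,1},c\sigma) < 0,\qquad \log\binom{p}{k} > 4+\log\big(k^2(p-k)\big),\qquad n > \frac{2\log\binom{p}{k}}{c^2\beta_{\min}^2\rho_{2k}^2}. $$ Then $\Pr(\widehat S = S^* )\to 1$ as $p\to\infty$.
   Context: Setting. $[p]=\{1,\dots,p\}$. One observes $y \in \mathbb{R}^n$ and $X \in \mathbb{R}^{n\times p}$ with $y = X\beta^* + w$, under the standing assumptions: (1) $\beta^*\in\mathbb{R}^p$ is $k$-sparse with support $S^*$, $|S^*|=k$; (2) $X$ is deterministic with columns satisfying $\|X_i\|_2^2/n = 1$ for all $i\in[p]$; (3) the entries of $w$ are i.i.d. zero-mean sub-Gaussian with parameter $\sigma$, i.e. $\mathbb{E}[\exp(t w_i)] \le \exp(t^2\sigma^2/2)$ for all $t\in\mathbb{R}$; (4) $n \ge k$; (5) $n$ and $k$ (and $X,\beta^*$) may vary with $p$ and $n,k$ are allowed to grow to infinity as $p\to\infty$. Loss. For $S\subset[p]$, $X_S$ is the submatrix of the columns of $X$ indexed by $S$, and $\mathcal{L}(S;y,X) = \min_{\alpha\in\mathbb{R}^{|S|}}\|y-X_S\alpha\|_2^2$.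 SWAP. Given an initial support $S^{(1)}$, set $r=1$. At step $r$, compute $L^{(r)}_{i,i'} = \mathcal{L}\big((S^{(r)}\setminus\{i\})\cup\{i'\};y,X\big)$ for all $i\in S^{(r)}$, $i'\in (S^{(r)})^c$. If $\min_{i,i'}L^{(r)}_{i,i'} < \mathcal{L}(S^{(r)};y,X)$, let $(\hat i,\hat i')$ be a minimizing pair (ties broken arbitrarily), set $S^{(r+1)} = (S^{(r)}\setminus\{\hat i\})\cup\{\hat i'\}$, increase $r$ by one and repeat. Otherwise stop and return $\widehat S = S^{(r)}$. Parameters. $\beta_{\min} = \min_{i\in S^*}|\beta^*_i|$, $$\rho_{k+\ell} = \inf\left\{\frac{\|X\theta\|_2^2}{n\|\theta\|_2^2} : \|\theta\|_0\le k+\ell,\ S^*\subseteq \mathrm{supp}(\theta)\right\},\qquad \rho_{k,\ell} = \inf\left\{\frac{\|X\theta\|_2^2}{n\|\theta\|_2^2} : \|\theta\|_0\le k,\ |S^*\cap \mathrm{supp}(\theta)|\ge \ell\right\},$$ so $\rho_{2k}$ is $\rho_{k+\ell}$ with $\ell=k$. Here $\|\theta\|_0$ is the number of non-zero entries of $\theta$. For $B\subset[p]$, $\Pi^\perp[B] = I - X_B(X_B^TX_B)^{-1}X_B^T$ and $\Sigma^B = X^T\Pi^\perp[B]X/n$; $\Sigma^B_{C,D}$ denotes the submatrix with rows $C$ and columns $D$. Let $\Omega_{k,d}$ be the set of all $S\subset[p]$ with $|S|=k$ that contain at least $k-d$ elements of $S^*$ (so $\Omega_{k,k}$ is the set of all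 supports of size $k$). Define $$\gamma_d = \max_{S\in\Omega_{k,d}\setminus\{S^*\}}\ \min_{i\in (S^* )^c\cap S}\ \frac{\left\|\Sigma^{S\setminus i}_{i,\bar S}\left(\Sigma^{S\setminus i}_{\bar S,\bar S}\right)^{-1}\right\|_1^2}{\Sigma^{S\setminus i}_{i,i}},\qquad \bar S = S^*\setminus S,$$ where $\|\cdot\|_1$ is the $\ell_1$-norm of a vector; $\gamma_k$ is the case $d=k$. Finally $$g(\delta,\rho,c) = (\delta-1)+2c\left(\sqrt{\delta}+1/\sqrt{\rho}\right)+2c^2.$$
   Formalization: The constant c is taken to be positive; the condition 0 < c² alone also allows negative c, for which g(γ_k, ρ_{k,1}, cσ) < 0 can hold with γ_k > 1 and the claim fails. *)

theory Defs
  imports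
    "HOL-Probability.Probability"
    "Jordan_Normal_Form.Gauss_Jordan_Elimination"
    "Jordan_Normal_Form.DL_Submatrix"
begin

hide_type (open) Finite_Cartesian_Product.vec
hide_const (open) Finite_Cartesian_Product.vec Finite_Cartesian_Product.mat

(* The index set [p] = {1,...,p} is rendered as {..<p}, following the 0-based indexing of
   Jordan_Normal_Form; n and p are read off as dim_row X and dim_col X. *)

definition supp :: "real Matrix.vec \<Rightarrow> nat set" where
  "supp v = {i. i < dim_vec v \<and> v $ i \<noteq> 0}"

definition norm0 :: "real Matrix.vec \<Rightarrow> nat" where
  "norm0 v = card (supp v)"

definition norm1 :: "real Matrix.vec \<Rightarrow> real" where
  "norm1 v = (\<Sum>i<dim_vec v. \<bar>v $ i\<bar>)"

definition norm2 :: "real Matrix.vec \<Rightarrow> real" where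
  "norm2 v = sqrt (v \<bullet> v)"

definition cols_sub :: "real Matrix.mat \<Rightarrow> nat set \<Rightarrow> real Matrix.mat" where
  "cols_sub X S = submatrix X UNIV S"

(* The infimum of the least-squares objective is always attained. *)
definition loss :: "real Matrix.vec \<Rightarrow> real Matrix.mat \<Rightarrow> nat set \<Rightarrow> real" where
  "loss y X S = (INF \<alpha>\<in>carrier_vec (card S). (norm2 (y - cols_sub X S *\<^sub>v \<alpha>))\<^sup>2)"

(* swap_run p L S T: T is a possible output, over all ways of breaking ties, of SWAP started
   at S, where L is the loss of a support. *)
inductive swap_run :: "nat \<Rightarrow> (nat set \<Rightarrow> real) \<Rightarrow> nat set \<Rightarrow> nat set \<Rightarrow> bool"
  for p :: nat and L :: "nat set \<Rightarrow> real" where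
  stop: "(\<And>i i'. i \<in> S \<Longrightarrow> i' \<in> {..<p} - S \<Longrightarrow> L S \<le> L ((S - {i}) \<union> {i'}))
    \<Longrightarrow> swap_run p L S S"
| swap: "is_arg_min (\<lambda>(i, i'). L ((S - {i}) \<union> {i'}))
           (\<lambda>(i, i'). i \<in> S \<and> i' \<in> {..<p} - S) (i, i')
    \<Longrightarrow> L ((S - {i}) \<union> {i'}) < L S
    \<Longrightarrow> swap_run p L ((S - {i}) \<union> {i'}) T
    \<Longrightarrow> swap_run p L S T"

lemma swap_run_exists:
  assumes "S \<subseteq> {..<p}"
  shows "\<exists>T. swap_run p L S T"
  using assms
proof (induction "card {T. T \<subseteq> {..<p} \<and> L T < L S}" arbitrary: S rule: less_induct)
  case less
  show ?case
  proof (cases "\<forall>i\<in>S. \<forall>i'\<in>{..<p} - S. L S \<le> L ((S - {i}) \<union> {i'})")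
    case True
    then show ?thesis by (blast intro: swap_run.stop)
  next
    case False
    let ?f = "\<lambda>(i, i'). L ((S - {i}) \<union> {i'})"
    let ?A = "S \<times> ({..<p} - S)"
    have fin: "finite ?A" using less.prems finite_subset by auto
    have ne: "?A \<noteq> {}" using False by auto
    obtain q where q: "is_arg_min ?f (\<lambda>x. x \<in> ?A) q"
      using ex_is_arg_min_if_finite[OF fin ne] by blast
    obtain i i' where qq: "q = (i, i')" by (cases q)
    have am: "is_arg_min ?f (\<lambda>(i, i'). i \<in> S \<and> i' \<in> {..<p} - S) (i, i')"
      using q unfolding qq is_arg_min_def by auto
    let ?S' = "(S - {i}) \<union> {i'}"
    obtain j j' where j: "j \<in> S" "j' \<in> {..<p} - S" "L ((S - {j}) \<union> {j'}) < L S"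
      using False by (auto simp: not_le)
    have "L ?S' \<le> L ((S - {j}) \<union> {j'})"
      using am j(1,2) unfolding is_arg_min_linorder by auto
    then have lt: "L ?S' < L S" using j(3) by linarith
    have sub: "?S' \<subseteq> {..<p}" using am less.prems unfolding is_arg_min_def by auto
    have "{T. T \<subseteq> {..<p} \<and> L T < L ?S'} \<subset> {T. T \<subseteq> {..<p} \<and> L T < L S}"
      using lt sub by fastforce
    moreover have "finite {T. T \<subseteq> {..<p} \<and> L T < L S}"
      by (rule finite_subset[of _ "Pow {..<p}"]) auto
    ultimately have "card {T. T \<subseteq> {..<p} \<and> L T < L ?S'} < card {T. T \<subseteq> {..<p} \<and> L T < L S}"
      by (rule psubset_card_mono[rotated])
    from less.hyps[OF this sub] obtain T where "swap_run p L ?S' T" by blast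
    then show ?thesis using swap_run.swap[OF am lt] by blast
  qed
qed

definition beta_min :: "real Matrix.vec \<Rightarrow> real" where
  "beta_min \<beta> = Min ((\<lambda>i. \<bar>\<beta> $ i\<bar>) ` supp \<beta>)"

(* rho_sup X Sstar (k + l) is rho_{k+l}. *)
definition rho_sup :: "real Matrix.mat \<Rightarrow> nat set \<Rightarrow> nat \<Rightarrow> real" where
  "rho_sup X Sstar s =
     Inf {(norm2 (X *\<^sub>v \<theta>))\<^sup>2 / (real (dim_row X) * (norm2 \<theta>)\<^sup>2) | \<theta>.
       \<theta> \<in> carrier_vec (dim_col X) \<and> norm0 \<theta> \<le> s \<and> Sstar \<subseteq> supp \<theta>}"

(* rho_cap X Sstar k l is rho_{k,l}. *)
definition rho_cap :: "real Matrix.mat \<Rightarrow> nat set \<Rightarrow> nat \<Rightarrow> nat \<Rightarrow> real" where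
  "rho_cap X Sstar k l =
     Inf {(norm2 (X *\<^sub>v \<theta>))\<^sup>2 / (real (dim_row X) * (norm2 \<theta>)\<^sup>2) | \<theta>.
       \<theta> \<in> carrier_vec (dim_col X) \<and> norm0 \<theta> \<le> k \<and> card (Sstar \<inter> supp \<theta>) \<ge> l}"

(* Meaningful for invertible A only; mat_inverse returns None for a singular matrix. *)
definition minv :: "real Matrix.mat \<Rightarrow> real Matrix.mat" where
  "minv A = the (mat_inverse A)"

definition proj_perp :: "real Matrix.mat \<Rightarrow> nat set \<Rightarrow> real Matrix.mat" where
  "proj_perp X B = (let XB = cols_sub X B in
     1\<^sub>m (dim_row X) - XB * minv (transpose_mat XB * XB) * transpose_mat XB)"

definition Sig :: "real Matrix.mat \<Rightarrow> nat set \<Rightarrow> real Matrix.mat" where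
  "Sig X B = (1 / real (dim_row X)) \<cdot>\<^sub>m (transpose_mat X * proj_perp X B * X)"

definition Omega :: "nat \<Rightarrow> nat set \<Rightarrow> nat \<Rightarrow> nat \<Rightarrow> nat set set" where
  "Omega p Sstar k d = {S. S \<subseteq> {..<p} \<and> card S = k \<and> card (S \<inter> Sstar) \<ge> k - d}"

(* The ratio inside the max-min defining gamma. If X_i lies in the span of the columns in
   S - {i}, the ratio is 0/0, which evaluates to 0. *)
definition gamma_ratio :: "real Matrix.mat \<Rightarrow> nat set \<Rightarrow> nat set \<Rightarrow> nat \<Rightarrow> real" where
  "gamma_ratio X Sstar S i =
     (let \<Sigma> = Sig X (S - {i}); Sbar = Sstar - S in
      (norm1 (row (submatrix \<Sigma> {i} Sbar * minv (submatrix \<Sigma> Sbar Sbar)) 0))\<^sup>2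
        / (\<Sigma> $$ (i, i)))"

definition gamma_d :: "real Matrix.mat \<Rightarrow> nat set \<Rightarrow> nat \<Rightarrow> nat \<Rightarrow> real" where
  "gamma_d X Sstar k d =
     (MAX S\<in>Omega (dim_col X) Sstar k d - {Sstar}. MIN i\<in>S - Sstar. gamma_ratio X Sstar S i)"

definition swap_g :: "real \<Rightarrow> real \<Rightarrow> real \<Rightarrow> real" where
  "swap_g \<delta> \<rho> c = (\<delta> - 1) + 2 * c * (sqrt \<delta> + 1 / sqrt \<rho>) + 2 * c\<^sup>2"

(* Integrability of exp (t W) has to be required: the integral of a non-integrable function
   is 0 by convention. *)
definition subgaussian :: "'a measure \<Rightarrow> real \<Rightarrow> ('a \<Rightarrow> real) \<Rightarrow> bool" where
  "subgaussian M \<sigma> W \<longleftrightarrow>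
     (\<forall>t. integrable M (\<lambda>\<omega>. exp (t * W \<omega>)) \<and>
          (\<integral>\<omega>. exp (t * W \<omega>) \<partial>M) \<le> exp (t\<^sup>2 * \<sigma>\<^sup>2 / 2))"

locale sparse_linear_model = prob_space M
  for M :: "'a measure" +
  fixes n p k :: nat
    and X :: "real Matrix.mat" and \<beta> :: "real Matrix.vec"
    and w :: "'a \<Rightarrow> real Matrix.vec" and \<sigma> :: real
  assumes X_carrier: "X \<in> carrier_mat n p"
    and beta_carrier: "\<beta> \<in> carrier_vec p"
    and w_carrier: "\<And>\<omega>. \<omega> \<in> space M \<Longrightarrow> w \<omega> \<in> carrier_vec n"
    and sparse: "card (supp \<beta>) = k"
    and col_norm: "\<And>i. i < p \<Longrightarrow> (norm2 (col X i))\<^sup>2 / real n = 1"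
    and indep: "indep_vars (\<lambda>_. borel) (\<lambda>i \<omega>. w \<omega> $ i) {..<n}"
    and ident: "\<And>i j. i < n \<Longrightarrow> j < n \<Longrightarrow>
      distr M borel (\<lambda>\<omega>. w \<omega> $ i) = distr M borel (\<lambda>\<omega>. w \<omega> $ j)"
    and zero_mean: "\<And>i. i < n \<Longrightarrow> integrable M (\<lambda>\<omega>. w \<omega> $ i) \<and> expectation (\<lambda>\<omega>. w \<omega> $ i) = 0"
    and sub_gauss: "\<And>i. i < n \<Longrightarrow> subgaussian M \<sigma> (\<lambda>\<omega>. w \<omega> $ i)"
    and k_le_n: "k \<le> n"

end

(* A swap that replaces i in S - S* by j in S* - S changes the squared distance of y to the span of
   the selected columns only along the unit vectors e_i, e_j obtained by normalising the residuals of
   X_i, X_j after projecting out B = S - {i}.  So the loss decreases as soon as |e_j . y| > |e_i . y|.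
   With i the minimiser in the definition of gamma and j the index maximising the noiseless
   correlation, Hoelder's inequality and the restricted eigenvalue rho_{2k} show that this can fail
   only if |e_i . w| + |e_j . w| >= sqrt n * rho_{2k} * beta_min * (1 - sqrt gamma).

   Because rho_{k,1} <= 1, the condition g < 0 gives 1 - sqrt gamma >= 2 c sigma (1 + c sigma / 2), and
   the extra factor 1 + c sigma / 2 is what makes a union bound over all (p choose k) supports succeed:
   the failure probability is at most 4 (p choose k) powr (- c sigma) <= 4 p powr (- c sigma).
   Off this event S* is the only local minimum, so the output is S* whatever the starting point and
   however ties are broken. *)
theory Submission
  imports Defs "Jordan_Normal_Form.Determinant"
begin

section \<open>Column selection and least squares\<close>

unbundle no inner_syntax and no vec_syntax

text \<open>For each wrong support the pair (i, j), and with it the two unit vectors, is fixed by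
  \<open>X\<close> and \<open>\<beta>\<close> before any noise is drawn. One event about two linear
  forms of the noise therefore serves each support, and together these events cover a random start
  and a random path. Measurability stays easy as well: the events involve linear forms only, not the
  random losses.

  Positivity of rho_{2k} does two jobs. A wrong support and the true one have at most 2k indices
  together, so the columns involved are linearly independent and the inverses in
  \<open>proj_perp\<close> and in the ratio for gamma are genuine, not default values. It also
  bounds the noiseless correlations from below, free of the number of missing indices.

  The constants meet exactly. |e . w| + |f . w| is the largest of four forms (+-e +- f) . w whose
  vectors have squared norm at most 4, so the tail exponent is tau^2 / (8 sigma^2). With 2 c sigma
  in place of 1 - sqrt gamma this is n rho^2 beta_min^2 c^2 / 2, which the condition on n puts just
  above log (p choose k). The room for decay comes from the quadratic term of g.\<close>

lemma bij_betw_pick: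
  assumes "finite S"
  shows "bij_betw (pick S) {..<card S} S"
proof (rule bij_betwI[where g = "\<lambda>i. card {a \<in> S. a < i}"])
  show "pick S \<in> {..<card S} \<rightarrow> S" by (auto intro: pick_in_set)
  show "(\<lambda>i. card {a \<in> S. a < i}) \<in> S \<rightarrow> {..<card S}"
    using assms by (auto intro!: psubset_card_mono)
qed (auto simp: card_pick_le pick_card_in_set)

lemma sum_pick:
  assumes "finite S"
  shows "(\<Sum>c<card S. f (pick S c)) = (\<Sum>i\<in>S. f i)"
  by (rule sum.reindex_bij_betw[OF bij_betw_pick[OF assms]])

text \<open>Trades positions in the compressed vector for the column indices themselves, so that
  sums over \<open>S\<close> replace sums over ranks.\<close>

lemma vec_eq_pick:
  assumes "\<alpha> \<in> carrier_vec (card S)"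
  obtains f where "\<alpha> = vec (card S) (\<lambda>c. f (pick S c))"
proof
  show "\<alpha> = vec (card S) (\<lambda>c. (\<lambda>i. \<alpha> $ card {a \<in> S. a < i}) (pick S c))"
    using assms by (intro eq_vecI) (auto simp: card_pick_le)
qed

lemma cols_sub_carrier:
  assumes "X \<in> carrier_mat n p" "S \<subseteq> {..<p}"
  shows "cols_sub X S \<in> carrier_mat n (card S)"
proof -
  have "{j. j < p \<and> j \<in> S} = S" using assms by auto
  then show ?thesis using assms by (auto simp: cols_sub_def submatrix_def)
qed

lemma submatrix_eq:
  assumes "A \<in> carrier_mat p q" "S \<subseteq> {..<p}" "T \<subseteq> {..<q}"
  shows "submatrix A S T = Matrix.mat (card S) (card T) (\<lambda>(r, c). A $$ (pick S r, pick T c))"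
proof -
  have "{j. j < p \<and> j \<in> S} = S" "{j. j < q \<and> j \<in> T} = T" using assms by auto
  then show ?thesis using assms by (auto simp: submatrix_def)
qed

lemma col_cols_sub:
  assumes "X \<in> carrier_mat n p" "S \<subseteq> {..<p}" "c < card S"
  shows "col (cols_sub X S) c = col X (pick S c)"
proof -
  have "{j. j < p \<and> j \<in> S} = S" using assms by auto
  moreover have "pick S c < p" using assms pick_in_set[of c S] by auto
  ultimately show ?thesis
    using assms by (intro eq_vecI) (auto simp: cols_sub_def submatrix_def pick_UNIV)
qed

lemma mult_mat_vec_index_sum:
  fixes A :: "real Matrix.mat"
  assumes "A \<in> carrier_mat a b" "v \<in> carrier_vec b" "r < a"
  shows "(A *\<^sub>v v) $ r = (\<Sum>c<b. A $$ (r, c) * v $ c)"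
  using assms by (auto simp: scalar_prod_def lessThan_atLeast0 intro!: sum.cong)

text \<open>Links the compressed vectors of the definitions to zero-padded ones of dimension
  \<open>p\<close>, so that losses and residuals can be described by \<open>X\<close> and
  \<open>supp\<close>.\<close>

lemma cols_sub_mult_vec:
  assumes "X \<in> carrier_mat n p" "S \<subseteq> {..<p}"
  shows "cols_sub X S *\<^sub>v vec (card S) (\<lambda>c. f (pick S c))
    = X *\<^sub>v vec p (\<lambda>i. if i \<in> S then f i else 0)" (is "?l = ?r")
proof (rule eq_vecI)
  have fS: "finite S" using assms finite_subset by blast
  note C = cols_sub_carrier[OF assms]
  show "dim_vec ?l = dim_vec ?r" using C assms by auto
  fix r assume "r < dim_vec ?r"
  then have r: "r < n" using assms by auto
  have "?l $ r = (\<Sum>c<card S. cols_sub X S $$ (r, c) * f (pick S c))"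
    using mult_mat_vec_index_sum[OF C _ r] by simp
  also have "\<dots> = (\<Sum>c<card S. X $$ (r, pick S c) * f (pick S c))"
  proof (intro sum.cong refl)
    fix c assume c: "c \<in> {..<card S}"
    have "pick S c < p" using assms c pick_in_set[of c S] by auto
    then show "cols_sub X S $$ (r, c) * f (pick S c) = X $$ (r, pick S c) * f (pick S c)"
      using arg_cong[OF col_cols_sub[OF assms, of c], of "\<lambda>v. v $ r"] c r C assms by auto
  qed
  also have "\<dots> = (\<Sum>i\<in>S. X $$ (r, i) * f i)" by (rule sum_pick[OF fS])
  also have "\<dots> = (\<Sum>i<p. X $$ (r, i) * (if i \<in> S then f i else 0))"
    using assms by (intro sum.mono_neutral_cong_left) auto
  also have "\<dots> = ?r $ r"
    using mult_mat_vec_index_sum[OF assms(1) _ r, of "vec p (\<lambda>i. if i \<in> S then f i else 0)"] by simp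
  finally show "?l $ r = ?r $ r" .
qed

lemma supp_vec_if: "supp (vec p (\<lambda>i. if i \<in> S then f i else 0)) \<subseteq> S"
  by (auto simp: supp_def split: if_splits)

lemma cols_sub_mult_vec_range:
  assumes "X \<in> carrier_mat n p" "S \<subseteq> {..<p}" "\<alpha> \<in> carrier_vec (card S)"
  obtains \<theta> where "\<theta> \<in> carrier_vec p" "supp \<theta> \<subseteq> S" "cols_sub X S *\<^sub>v \<alpha> = X *\<^sub>v \<theta>"
proof -
  obtain f where "\<alpha> = vec (card S) (\<lambda>c. f (pick S c))" using vec_eq_pick[OF assms(3)] .
  then show thesis
    using that[of "vec p (\<lambda>i. if i \<in> S then f i else 0)"] cols_sub_mult_vec[OF assms(1,2)] supp_vec_if
    by auto
qed

lemma mult_vec_cols_sub_range: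
  assumes "X \<in> carrier_mat n p" "S \<subseteq> {..<p}" "\<theta> \<in> carrier_vec p" "supp \<theta> \<subseteq> S"
  obtains \<alpha> where "\<alpha> \<in> carrier_vec (card S)" "cols_sub X S *\<^sub>v \<alpha> = X *\<^sub>v \<theta>"
proof
  have "vec p (\<lambda>i. if i \<in> S then \<theta> $ i else 0) = \<theta>"
    using assms by (intro eq_vecI) (auto simp: supp_def)
  then show "cols_sub X S *\<^sub>v vec (card S) (\<lambda>c. \<theta> $ pick S c) = X *\<^sub>v \<theta>"
    using cols_sub_mult_vec[OF assms(1,2), of "\<lambda>i. \<theta> $ i"] by simp
qed simp

lemma norm2_sq: "(norm2 v)\<^sup>2 = v \<bullet> v"
  by (simp add: norm2_def scalar_prod_def sum_nonneg)

lemma scalar_prod_self_nonneg: "0 \<le> (v :: real Matrix.vec) \<bullet> v"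
  by (simp add: scalar_prod_def sum_nonneg)

lemma scalar_prod_mult_mat_vec:
  fixes X :: "real Matrix.mat"
  assumes "X \<in> carrier_mat n p" "u \<in> carrier_vec n" "\<theta> \<in> carrier_vec p"
  shows "u \<bullet> (X *\<^sub>v \<theta>) = (\<Sum>j<p. \<theta> $ j * (u \<bullet> col X j))"
proof -
  have "u \<bullet> (X *\<^sub>v \<theta>) = (\<Sum>r<n. u $ r * (\<Sum>c<p. X $$ (r, c) * \<theta> $ c))"
    using assms by (auto simp: scalar_prod_def lessThan_atLeast0 intro!: sum.cong)
  also have "\<dots> = (\<Sum>r<n. \<Sum>c<p. \<theta> $ c * (u $ r * X $$ (r, c)))"
    by (simp add: sum_distrib_left mult_ac)
  also have "\<dots> = (\<Sum>c<p. \<Sum>r<n. \<theta> $ c * (u $ r * X $$ (r, c)))"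
    by (rule sum.swap)
  also have "\<dots> = (\<Sum>j<p. \<theta> $ j * (u \<bullet> col X j))"
    using assms by (auto simp: scalar_prod_def lessThan_atLeast0 sum_distrib_left intro!: sum.cong)
  finally show ?thesis .
qed

text \<open>Injectivity makes the determinant nonzero, so \<open>mat_inverse\<close> returns a
  \<open>Some\<close> and \<open>minv\<close> is the true inverse rather than
  \<open>the None\<close>.\<close>

lemma minv_inverse:
  assumes A: "A \<in> carrier_mat d d"
    and inj: "\<And>v. v \<in> carrier_vec d \<Longrightarrow> A *\<^sub>v v = 0\<^sub>v d \<Longrightarrow> v = 0\<^sub>v d"
  shows "minv A \<in> carrier_mat d d" "A * minv A = 1\<^sub>m d" "minv A * A = 1\<^sub>m d"
proof -
  have "det A \<noteq> 0" using inj det_0_iff_vec_prod_zero_field[OF A] by auto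
  from det_non_zero_imp_unit[OF A this, of undefined]
  have "mat_inverse A \<noteq> None" using mat_inverse(1)[OF A, of undefined] by auto
  then obtain C where "mat_inverse A = Some C" by auto
  with mat_inverse(2)[OF A this] show "minv A \<in> carrier_mat d d" "A * minv A = 1\<^sub>m d" "minv A * A = 1\<^sub>m d"
    by (auto simp: minv_def)
qed

section \<open>The loss as an infimum over vectors supported in \<open>S\<close>\<close>

lemma loss_le:
  assumes "X \<in> carrier_mat n p" "S \<subseteq> {..<p}" "\<theta> \<in> carrier_vec p" "supp \<theta> \<subseteq> S"
  shows "loss y X S \<le> (y - X *\<^sub>v \<theta>) \<bullet> (y - X *\<^sub>v \<theta>)"
proof -
  obtain \<alpha> where \<alpha>: "\<alpha> \<in> carrier_vec (card S)" "cols_sub X S *\<^sub>v \<alpha> = X *\<^sub>v \<theta>"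
    using mult_vec_cols_sub_range[OF assms] .
  have "bdd_below ((\<lambda>\<alpha>. (norm2 (y - cols_sub X S *\<^sub>v \<alpha>))\<^sup>2) ` carrier_vec (card S))"
    by (rule bdd_belowI[of _ 0]) auto
  from cINF_lower[OF this \<alpha>(1)] show ?thesis
    using \<alpha>(2) by (simp add: loss_def norm2_sq)
qed

lemma loss_ge:
  assumes "X \<in> carrier_mat n p" "S \<subseteq> {..<p}"
    and "\<And>\<theta>. \<theta> \<in> carrier_vec p \<Longrightarrow> supp \<theta> \<subseteq> S \<Longrightarrow> b \<le> (y - X *\<^sub>v \<theta>) \<bullet> (y - X *\<^sub>v \<theta>)"
  shows "b \<le> loss y X S"
  unfolding loss_def
proof (rule cINF_greatest)
  show "carrier_vec (card S) \<noteq> ({} :: real Matrix.vec set)" using zero_carrier_vec by blast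
  fix \<alpha> :: "real Matrix.vec" assume "\<alpha> \<in> carrier_vec (card S)"
  then obtain \<theta> where "\<theta> \<in> carrier_vec p" "supp \<theta> \<subseteq> S" "cols_sub X S *\<^sub>v \<alpha> = X *\<^sub>v \<theta>"
    using cols_sub_mult_vec_range[OF assms(1,2)] by blast
  then show "b \<le> (norm2 (y - cols_sub X S *\<^sub>v \<alpha>))\<^sup>2"
    using assms(3) by (simp add: norm2_sq)
qed

section \<open>Gram matrices and residuals after projecting out a column set\<close>

lemma scalar_prod_self_eq_0:
  fixes v :: "real Matrix.vec"
  assumes "v \<in> carrier_vec n" "v \<bullet> v = 0"
  shows "v = 0\<^sub>v n"
proof (rule eq_vecI)
  fix i assume "i < dim_vec (0\<^sub>v n :: real Matrix.vec)"
  then have "i \<in> {0..<dim_vec v}" using assms by auto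
  moreover have "\<forall>i\<in>{0..<dim_vec v}. v $ i * v $ i = 0"
    using assms(2) unfolding scalar_prod_def by (subst (asm) sum_nonneg_eq_0_iff) auto
  ultimately show "v $ i = 0\<^sub>v n $ i" using assms by auto
qed (use assms in auto)

text \<open>If the Gram matrix kills v, then |A v|^2 = 0, so injectivity of \<open>A\<close> passes
  to it.\<close>

lemma gram_inverse:
  fixes A :: "real Matrix.mat"
  assumes A: "A \<in> carrier_mat n d"
    and inj: "\<And>v. v \<in> carrier_vec d \<Longrightarrow> A *\<^sub>v v = 0\<^sub>v n \<Longrightarrow> v = 0\<^sub>v d"
  shows "minv (transpose_mat A * A) \<in> carrier_mat d d"
    and "transpose_mat A * A * minv (transpose_mat A * A) = 1\<^sub>m d"
proof -
  have "v = 0\<^sub>v d" if v: "v \<in> carrier_vec d" "(transpose_mat A * A) *\<^sub>v v = 0\<^sub>v d" for v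
  proof (rule inj[OF v(1)], rule scalar_prod_self_eq_0)
    have "(A *\<^sub>v v) \<bullet> (A *\<^sub>v v) = (transpose_mat A *\<^sub>v (A *\<^sub>v v)) \<bullet> v"
      using A v by (intro transpose_vec_mult_scalar[symmetric]) auto
    also have "transpose_mat A *\<^sub>v (A *\<^sub>v v) = 0\<^sub>v d"
      using v A by (metis assoc_mult_mat_vec transpose_carrier_mat)
    finally show "(A *\<^sub>v v) \<bullet> (A *\<^sub>v v) = 0" using v by simp
  qed (use A v in auto)
  moreover have "transpose_mat A * A \<in> carrier_mat d d" using A by auto
  ultimately show "minv (transpose_mat A * A) \<in> carrier_mat d d"
    "transpose_mat A * A * minv (transpose_mat A * A) = 1\<^sub>m d"
    using minv_inverse by blast+
qed

lemma scalar_prod_minus_smult_self: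
  fixes a b :: "real Matrix.vec"
  assumes "a \<in> carrier_vec n" "b \<in> carrier_vec n"
  shows "(a - t \<cdot>\<^sub>v b) \<bullet> (a - t \<cdot>\<^sub>v b) = a \<bullet> a - 2 * t * (b \<bullet> a) + t\<^sup>2 * (b \<bullet> b)"
  using assms
  by (simp add: scalar_prod_def sum_subtractf[symmetric] sum.distrib[symmetric] sum_distrib_left
      power2_eq_square algebra_simps)

lemma scalar_prod_add_self:
  fixes a b :: "real Matrix.vec"
  assumes "a \<in> carrier_vec n" "b \<in> carrier_vec n"
  shows "(a + b) \<bullet> (a + b) = a \<bullet> a + 2 * (b \<bullet> a) + b \<bullet> b"
  using assms
  by (simp add: scalar_prod_def sum.distrib[symmetric] sum_distrib_left algebra_simps)

lemma mult_mat_unit_vec: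
  fixes X :: "real Matrix.mat"
  assumes "X \<in> carrier_mat n p" "j < p"
  shows "X *\<^sub>v unit_vec p j = col X j"
  using assms by (intro eq_vecI) auto

text \<open>\<open>B_inj\<close> is linear independence of the columns in \<open>B\<close>, phrased
  with padded vectors. It makes the inverse in \<open>proj_perp\<close> genuine, so that
  \<open>R\<close> is the orthogonal projection onto the complement of their span.\<close>

locale residual =
  fixes X :: "real Matrix.mat" and n p :: nat and B :: "nat set"
  assumes X_mat: "X \<in> carrier_mat n p"
    and B_sub: "B \<subseteq> {..<p}"
    and B_inj: "\<And>\<theta>. \<theta> \<in> carrier_vec p \<Longrightarrow> supp \<theta> \<subseteq> B \<Longrightarrow> X *\<^sub>v \<theta> = 0\<^sub>v n \<Longrightarrow> \<theta> = 0\<^sub>v p"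
begin

abbreviation R :: "real Matrix.vec \<Rightarrow> real Matrix.vec" where
  "R v \<equiv> proj_perp X B *\<^sub>v v"

lemma cols_sub_inj:
  assumes "v \<in> carrier_vec (card B)" "cols_sub X B *\<^sub>v v = 0\<^sub>v n"
  shows "v = 0\<^sub>v (card B)"
proof -
  obtain f where f: "v = vec (card B) (\<lambda>c. f (pick B c))" using vec_eq_pick[OF assms(1)] .
  let ?\<theta> = "vec p (\<lambda>i. if i \<in> B then f i else 0)"
  have "X *\<^sub>v ?\<theta> = 0\<^sub>v n" using cols_sub_mult_vec[OF X_mat B_sub, of f] f assms by simp
  then have th: "?\<theta> = 0\<^sub>v p" by (intro B_inj supp_vec_if) auto
  have "f i = 0" if "i \<in> B" for i
    using arg_cong[OF th, of "\<lambda>v. v $ i"] that B_sub by auto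
  then show ?thesis unfolding f by (intro eq_vecI) (auto simp: pick_in_set)
qed

lemma resid_eq:
  assumes "v \<in> carrier_vec n"
  shows "R v = v - cols_sub X B *\<^sub>v (minv (transpose_mat (cols_sub X B) * cols_sub X B) *\<^sub>v
    (transpose_mat (cols_sub X B) *\<^sub>v v))"
proof -
  let ?C = "cols_sub X B" and ?M = "minv (transpose_mat (cols_sub X B) * cols_sub X B)"
  note C = cols_sub_carrier[OF X_mat B_sub]
  note M = gram_inverse(1)[OF C cols_sub_inj]
  have T: "transpose_mat ?C \<in> carrier_mat (card B) n" using C by simp
  have Tv: "transpose_mat ?C *\<^sub>v v \<in> carrier_vec (card B)" using T assms by (rule mult_mat_vec_carrier)
  have CM: "?C * ?M \<in> carrier_mat n (card B)" using C M by (rule mult_carrier_mat)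
  have "R v = 1\<^sub>m n *\<^sub>v v - (?C * ?M * transpose_mat ?C) *\<^sub>v v"
    unfolding proj_perp_def Let_def carrier_matD(1)[OF X_mat]
    by (rule minus_mult_distrib_mat_vec[OF one_carrier_mat mult_carrier_mat[OF CM T] assms])
  also have "(?C * ?M * transpose_mat ?C) *\<^sub>v v = ?C *\<^sub>v (?M *\<^sub>v (transpose_mat ?C *\<^sub>v v))"
    by (rule trans[OF assoc_mult_mat_vec[OF CM T assms] assoc_mult_mat_vec[OF C M Tv]])
  finally show ?thesis using assms by simp
qed

lemma proj_perp_carrier: "proj_perp X B \<in> carrier_mat n n"
proof -
  note C = cols_sub_carrier[OF X_mat B_sub]
  note G = gram_inverse[OF C cols_sub_inj]
  show ?thesis unfolding proj_perp_def Let_def using C X_mat G(1)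
    by (auto intro!: minus_carrier_mat mult_carrier_mat)
qed

lemma resid_carrier: "v \<in> carrier_vec n \<Longrightarrow> R v \<in> carrier_vec n"
  using proj_perp_carrier by auto

text \<open>With \<open>resid_orth\<close> this characterises \<open>R v\<close> as the orthogonal
  residual; later arguments use these two facts instead of the explicit inverse.\<close>

lemma resid_decomp:
  assumes "v \<in> carrier_vec n"
  obtains \<theta> where "\<theta> \<in> carrier_vec p" "supp \<theta> \<subseteq> B" "v = R v + X *\<^sub>v \<theta>"
proof -
  note C = cols_sub_carrier[OF X_mat B_sub]
  note G = gram_inverse[OF C cols_sub_inj]
  let ?\<alpha> = "minv (transpose_mat (cols_sub X B) * cols_sub X B) *\<^sub>v (transpose_mat (cols_sub X B) *\<^sub>v v)"
  have "?\<alpha> \<in> carrier_vec (card B)" using C G(1) assms by auto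
  from cols_sub_mult_vec_range[OF X_mat B_sub this]
  obtain \<theta> where \<theta>: "\<theta> \<in> carrier_vec p" "supp \<theta> \<subseteq> B" "cols_sub X B *\<^sub>v ?\<alpha> = X *\<^sub>v \<theta>" .
  have "R v = v - X *\<^sub>v \<theta>" using resid_eq[OF assms] \<theta>(3) by simp
  then have "v = R v + X *\<^sub>v \<theta>" using assms X_mat \<theta>(1) by (intro eq_vecI) auto
  with \<theta> that show thesis by blast
qed

text \<open>These are the normal equations: multiplying the explicit formula by the transpose of the
  column submatrix cancels the Gram matrix against its inverse.\<close>

lemma resid_orth:
  assumes v: "v \<in> carrier_vec n" and \<theta>: "\<theta> \<in> carrier_vec p" "supp \<theta> \<subseteq> B"
  shows "(X *\<^sub>v \<theta>) \<bullet> R v = 0"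
proof -
  note C = cols_sub_carrier[OF X_mat B_sub]
  note G = gram_inverse[OF C cols_sub_inj]
  let ?T = "transpose_mat (cols_sub X B)" and ?M = "minv (transpose_mat (cols_sub X B) * cols_sub X B)"
  obtain \<alpha> where \<alpha>: "\<alpha> \<in> carrier_vec (card B)" "cols_sub X B *\<^sub>v \<alpha> = X *\<^sub>v \<theta>"
    using mult_vec_cols_sub_range[OF X_mat B_sub \<theta>] .
  have Tv: "?T *\<^sub>v v \<in> carrier_vec (card B)" using C v by auto
  have "?T *\<^sub>v (cols_sub X B *\<^sub>v (?M *\<^sub>v (?T *\<^sub>v v))) = (?T * cols_sub X B * ?M) *\<^sub>v (?T *\<^sub>v v)"
    using C G(1) Tv by (subst assoc_mult_mat_vec[of _ "card B" "card B" _ "card B"])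
      (auto simp: assoc_mult_mat_vec[of _ _ n])
  also have "\<dots> = ?T *\<^sub>v v" using G(2) Tv by simp
  finally have "?T *\<^sub>v R v = 0\<^sub>v (card B)"
    unfolding resid_eq[OF v] using C G(1) v Tv
    by (subst mult_minus_distrib_mat_vec[of _ "card B" n]) auto
  moreover have "R v \<bullet> (cols_sub X B *\<^sub>v \<alpha>) = (?T *\<^sub>v R v) \<bullet> \<alpha>"
    using C \<alpha>(1) resid_carrier[OF v] by (intro transpose_vec_mult_scalar[symmetric]) auto
  ultimately have "R v \<bullet> (X *\<^sub>v \<theta>) = 0" using \<alpha> by simp
  then show ?thesis using comm_scalar_prod[OF resid_carrier[OF v], of "X *\<^sub>v \<theta>"] X_mat \<theta> by auto
qed

text \<open>Symmetry and idempotence of the projection in one identity: the part of \<open>u\<close>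
  in the span of \<open>B\<close> is orthogonal to \<open>R v\<close>.\<close>

lemma scalar_prod_resid:
  assumes "u \<in> carrier_vec n" "v \<in> carrier_vec n"
  shows "u \<bullet> R v = R u \<bullet> R v"
proof -
  obtain \<theta> where \<theta>: "\<theta> \<in> carrier_vec p" "supp \<theta> \<subseteq> B" "u = R u + X *\<^sub>v \<theta>"
    using resid_decomp[OF assms(1)] .
  have "u \<bullet> R v = (R u + X *\<^sub>v \<theta>) \<bullet> R v" using \<theta>(3) by simp
  also have "\<dots> = R u \<bullet> R v + (X *\<^sub>v \<theta>) \<bullet> R v"
    using assms resid_carrier X_mat \<theta>(1) by (intro add_scalar_prod_distrib[of _ n]) auto
  finally show ?thesis using resid_orth[OF assms(2) \<theta>(1,2)] by simp
qed

lemma resid_scalar_prod: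
  assumes "u \<in> carrier_vec n" "v \<in> carrier_vec n"
  shows "R u \<bullet> v = R u \<bullet> R v"
  using scalar_prod_resid[OF assms(2,1)] assms resid_carrier comm_scalar_prod[of _ n]
  by metis

lemma resid_col_0:
  assumes "v \<in> carrier_vec n" "b \<in> B"
  shows "R v \<bullet> col X b = 0"
proof -
  have b: "b < p" using assms B_sub by auto
  have "(X *\<^sub>v unit_vec p b) \<bullet> R v = 0"
    using assms b by (intro resid_orth) (auto simp: supp_def unit_vec_def split: if_splits)
  moreover have "X *\<^sub>v unit_vec p b = col X b" using X_mat b by (intro mult_mat_unit_vec) auto
  ultimately show ?thesis
    using comm_scalar_prod[OF resid_carrier[OF assms(1)], of "col X b"] X_mat b by auto
qed

text \<open>Adjoining one column enlarges the fitted space by the single direction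
  \<open>R (col X j)\<close>, and the optimal loss drops by the squared component of
  \<open>y\<close> along it. Used with the same \<open>B\<close> and two different columns, this
  turns the comparison of losses in a swap into a comparison of two such components.\<close>

lemma loss_insert:
  assumes j: "j < p" "j \<notin> B" and pos: "R (col X j) \<bullet> R (col X j) > 0" and y: "y \<in> carrier_vec n"
  shows "loss y X (insert j B) = R y \<bullet> R y - (R (col X j) \<bullet> y)\<^sup>2 / (R (col X j) \<bullet> R (col X j))"
proof (rule antisym)
  let ?x = "col X j"
  have x: "?x \<in> carrier_vec n" using X_mat j by auto
  let ?e = "unit_vec p j :: real Matrix.vec"
  have e: "?e \<in> carrier_vec p" "X *\<^sub>v ?e = ?x" using X_mat j by (auto intro!: mult_mat_unit_vec)
  obtain \<theta>1 where \<theta>1: "\<theta>1 \<in> carrier_vec p" "supp \<theta>1 \<subseteq> B" "y = R y + X *\<^sub>v \<theta>1"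
    using resid_decomp[OF y] .
  obtain \<theta>2 where \<theta>2: "\<theta>2 \<in> carrier_vec p" "supp \<theta>2 \<subseteq> B" "?x = R ?x + X *\<^sub>v \<theta>2"
    using resid_decomp[OF x] .
  have S: "insert j B \<subseteq> {..<p}" using j B_sub by auto
  have zero: "\<theta>1 $ l = 0" "\<theta>2 $ l = 0" if "l < p" "l \<notin> B" for l
    using that \<theta>1(1,2) \<theta>2(1,2) by (auto simp: supp_def)
  have Ry: "R y \<in> carrier_vec n" and Rx: "R ?x \<in> carrier_vec n" using resid_carrier x y by auto
  have c: "X *\<^sub>v \<theta>1 \<in> carrier_vec n" "X *\<^sub>v \<theta>2 \<in> carrier_vec n" using X_mat \<theta>1 \<theta>2 by auto
  have sym: "R ?x \<bullet> y = R ?x \<bullet> R y" by (rule resid_scalar_prod[OF x y])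
  let ?D = "R ?x \<bullet> R ?x"
  let ?N = "R ?x \<bullet> R y"
  \<comment> \<open>Coefficient of the one-dimensional regression of \<open>R y\<close> on
    \<open>R ?x\<close>. The term with \<open>\<theta>2\<close> corrects the fit on \<open>B\<close>
    once column \<open>j\<close> has weight \<open>t\<close>.\<close>
  define t where "t = ?N / ?D"
  let ?\<theta> = "\<theta>1 - t \<cdot>\<^sub>v \<theta>2 + t \<cdot>\<^sub>v ?e"
  have "X *\<^sub>v ?\<theta> = X *\<^sub>v (\<theta>1 - t \<cdot>\<^sub>v \<theta>2) + t \<cdot>\<^sub>v (X *\<^sub>v ?e)"
    using X_mat \<theta>1(1) \<theta>2(1) e(1)
    by (simp add: mult_add_distrib_mat_vec[of _ n p] mult_mat_vec[of _ n p])
  also have "X *\<^sub>v (\<theta>1 - t \<cdot>\<^sub>v \<theta>2) = X *\<^sub>v \<theta>1 - t \<cdot>\<^sub>v (X *\<^sub>v \<theta>2)"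
    using X_mat \<theta>1(1) \<theta>2(1)
    by (simp add: mult_minus_distrib_mat_vec[of _ n p] mult_mat_vec[of _ n p])
  finally have X\<theta>: "X *\<^sub>v ?\<theta> = X *\<^sub>v \<theta>1 - t \<cdot>\<^sub>v (X *\<^sub>v \<theta>2) + t \<cdot>\<^sub>v ?x" using e by simp
  have "y - X *\<^sub>v ?\<theta> = R y - t \<cdot>\<^sub>v R ?x"
  proof (rule eq_vecI)
    fix r assume "r < dim_vec (R y - t \<cdot>\<^sub>v R ?x)"
    then have r: "r < n" using carrier_vecD[OF Rx] by simp
    have "y $ r = R y $ r + (X *\<^sub>v \<theta>1) $ r" "?x $ r = R ?x $ r + (X *\<^sub>v \<theta>2) $ r"
      using arg_cong[OF \<theta>1(3), of "\<lambda>v. v $ r"] arg_cong[OF \<theta>2(3), of "\<lambda>v. v $ r"] r c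
      by (simp_all add: carrier_matD(1)[OF X_mat] del: index_mult_mat_vec)
    then show "(y - X *\<^sub>v ?\<theta>) $ r = (R y - t \<cdot>\<^sub>v R ?x) $ r"
      unfolding X\<theta> using r c x Rx Ry by (simp add: carrier_matD(1)[OF X_mat] carrier_matD(1)[OF proj_perp_carrier] algebra_simps del: index_mult_mat_vec index_col)
  qed (use X_mat carrier_matD(1)[OF proj_perp_carrier] in auto)
  moreover have "supp ?\<theta> \<subseteq> insert j B"
    using \<theta>1(1) \<theta>2(1) zero by (auto simp: supp_def unit_vec_def split: if_splits)
  moreover have "?\<theta> \<in> carrier_vec p" using \<theta>1 \<theta>2 by auto
  ultimately have "loss y X (insert j B) \<le> (R y - t \<cdot>\<^sub>v R ?x) \<bullet> (R y - t \<cdot>\<^sub>v R ?x)"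
    using loss_le[OF X_mat S, of ?\<theta> y] by simp
  also have "\<dots> = R y \<bullet> R y - (R ?x \<bullet> y)\<^sup>2 / ?D"
    using pos unfolding scalar_prod_minus_smult_self[OF Ry Rx] sym t_def
    by (simp add: field_simps power2_eq_square)
  finally show "loss y X (insert j B) \<le> R y \<bullet> R y - (R ?x \<bullet> y)\<^sup>2 / ?D" .

  show "R y \<bullet> R y - (R ?x \<bullet> y)\<^sup>2 / ?D \<le> loss y X (insert j B)"
  proof (rule loss_ge[OF X_mat S])
    fix \<theta> assume \<theta>: "\<theta> \<in> carrier_vec p" "supp \<theta> \<subseteq> insert j B"
    \<comment> \<open>For an arbitrary competitor the error is \<open>R y - s R ?x\<close> plus a
      vector in the span of \<open>B\<close>. By Pythagoras, dropping the latter can only lower the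
      value, and a quadratic in \<open>s\<close> remains.\<close>
    define s where "s = \<theta> $ j"
    let ?q = "R y - s \<cdot>\<^sub>v R ?x"
    let ?\<phi> = "\<theta>1 - (\<theta> - s \<cdot>\<^sub>v ?e) - s \<cdot>\<^sub>v \<theta>2"
    have \<phi>: "?\<phi> \<in> carrier_vec p" using \<theta>1 \<theta>2 \<theta> by auto
    have supp: "supp ?\<phi> \<subseteq> B"
      using \<theta>1(1) \<theta>2(1) \<theta> j zero by (auto simp: supp_def unit_vec_def s_def split: if_splits)
    have X\<phi>: "X *\<^sub>v ?\<phi> = X *\<^sub>v \<theta>1 - (X *\<^sub>v \<theta> - s \<cdot>\<^sub>v ?x) - s \<cdot>\<^sub>v (X *\<^sub>v \<theta>2)"
      using X_mat \<theta>1(1) \<theta>2(1) \<theta>(1) e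
      by (simp add: mult_minus_distrib_mat_vec[of _ n p] mult_mat_vec[of _ n p])
    have q: "?q \<in> carrier_vec n" and X\<phi>c: "X *\<^sub>v ?\<phi> \<in> carrier_vec n" and c3: "X *\<^sub>v \<theta> \<in> carrier_vec n"
      using Ry Rx X_mat \<phi> \<theta> by auto
    have "y - X *\<^sub>v \<theta> = ?q + X *\<^sub>v ?\<phi>"
    proof (rule eq_vecI)
      fix r assume "r < dim_vec (?q + X *\<^sub>v ?\<phi>)"
      then have r: "r < n" using X_mat by auto
      have "y $ r = R y $ r + (X *\<^sub>v \<theta>1) $ r" "?x $ r = R ?x $ r + (X *\<^sub>v \<theta>2) $ r"
        using arg_cong[OF \<theta>1(3), of "\<lambda>v. v $ r"] arg_cong[OF \<theta>2(3), of "\<lambda>v. v $ r"] r c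
        by (simp_all add: carrier_matD(1)[OF X_mat] del: index_mult_mat_vec)
      then show "(y - X *\<^sub>v \<theta>) $ r = (?q + X *\<^sub>v ?\<phi>) $ r"
        unfolding X\<phi> using r c c3 x Rx Ry by (simp add: carrier_matD(1)[OF X_mat] carrier_matD(1)[OF proj_perp_carrier] algebra_simps del: index_mult_mat_vec index_col)
    qed (use X_mat proj_perp_carrier in auto)
    then have "(y - X *\<^sub>v \<theta>) \<bullet> (y - X *\<^sub>v \<theta>)
        = ?q \<bullet> ?q + 2 * ((X *\<^sub>v ?\<phi>) \<bullet> ?q) + (X *\<^sub>v ?\<phi>) \<bullet> (X *\<^sub>v ?\<phi>)"
      using scalar_prod_add_self[OF q X\<phi>c] by simp
    moreover have "(X *\<^sub>v ?\<phi>) \<bullet> ?q = 0"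
      using resid_orth[OF y \<phi> supp] resid_orth[OF x \<phi> supp] Ry Rx X\<phi>c
      by (simp add: scalar_prod_minus_distrib[of _ n])
    ultimately have "?q \<bullet> ?q \<le> (y - X *\<^sub>v \<theta>) \<bullet> (y - X *\<^sub>v \<theta>)"
      using scalar_prod_self_nonneg[of "X *\<^sub>v ?\<phi>"] by simp
    moreover have "R y \<bullet> R y - (R ?x \<bullet> y)\<^sup>2 / ?D \<le> ?q \<bullet> ?q"
    proof -
      \<comment> \<open>Completing the square: no \<open>s\<close> beats
        \<open>?N / ?D\<close>.\<close>
      have "0 \<le> (s * ?D - ?N)\<^sup>2" by simp
      then have "2 * s * ?N * ?D - s\<^sup>2 * ?D * ?D \<le> ?N\<^sup>2" by (simp add: power2_eq_square algebra_simps)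
      then have "2 * s * ?N - s\<^sup>2 * ?D \<le> ?N\<^sup>2 / ?D" using pos by (simp add: field_simps)
      then show ?thesis unfolding scalar_prod_minus_smult_self[OF Ry Rx] sym by linarith
    qed
    ultimately show "R y \<bullet> R y - (R ?x \<bullet> y)\<^sup>2 / ?D \<le> (y - X *\<^sub>v \<theta>) \<bullet> (y - X *\<^sub>v \<theta>)" by linarith
  qed
qed

text \<open>As the projection is symmetric and idempotent, \<open>Sig\<close> is the scaled Gram
  matrix of the residual columns.\<close>

lemma Sig_index:
  assumes "a < p" "b < p"
  shows "Sig X B $$ (a, b) = (R (col X a) \<bullet> R (col X b)) / real n"
proof -
  note P = proj_perp_carrier
  have "(transpose_mat X * proj_perp X B * X) $$ (a, b) = (transpose_mat X * (proj_perp X B * X)) $$ (a, b)"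
    using X_mat P by (subst assoc_mult_mat[of _ p n _ n _ p]) auto
  also have "\<dots> = col X a \<bullet> R (col X b)"
    using X_mat P assms by simp
  also have "\<dots> = R (col X a) \<bullet> R (col X b)"
    using X_mat assms by (intro scalar_prod_resid) auto
  finally show ?thesis using X_mat P assms by (simp add: Sig_def)
qed

lemma Sig_carrier: "Sig X B \<in> carrier_mat p p"
  using X_mat by (auto simp: Sig_def)

end

section \<open>Restricted eigenvalues and the improving swap\<close>

(* rho_sup only tests vectors whose support contains S0; the other vectors are limits of
   theta + epsilon * 1_{S0} as epsilon tends to 0. *)
lemma restricted_eigenvalue_of_rho_sup:
  fixes X :: "real Matrix.mat"
  assumes X: "X \<in> carrier_mat n p" and n: "n > 0" and S0: "S0 \<subseteq> {..<p}"
    and \<theta>: "\<theta> \<in> carrier_vec p" and card: "card (S0 \<union> supp \<theta>) \<le> m"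
  shows "real n * rho_sup X S0 m * (\<theta> \<bullet> \<theta>) \<le> (X *\<^sub>v \<theta>) \<bullet> (X *\<^sub>v \<theta>)"
proof -
  define h :: "real Matrix.vec" where "h = vec p (\<lambda>i. if i \<in> S0 then 1 else 0)"
  have h: "h \<in> carrier_vec p" by (simp add: h_def)
  let ?\<rho> = "rho_sup X S0 m"
  have fin: "finite S0" using S0 finite_subset by blast
  have full: "real n * ?\<rho> * (\<phi> \<bullet> \<phi>) \<le> (X *\<^sub>v \<phi>) \<bullet> (X *\<^sub>v \<phi>)"
    if \<phi>: "\<phi> \<in> carrier_vec p" "norm0 \<phi> \<le> m" "S0 \<subseteq> supp \<phi>" for \<phi>
  proof (cases "\<phi> \<bullet> \<phi> = 0")
    case False
    then have pos: "\<phi> \<bullet> \<phi> > 0" using scalar_prod_self_nonneg[of \<phi>] by simp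
    have "?\<rho> \<le> (norm2 (X *\<^sub>v \<phi>))\<^sup>2 / (real (dim_row X) * (norm2 \<phi>)\<^sup>2)"
      unfolding rho_sup_def using \<phi> X by (intro cInf_lower bdd_belowI[of _ 0]) auto
    then show ?thesis using pos n X by (simp add: norm2_sq field_simps)
  qed (simp add: scalar_prod_self_nonneg)
  \<comment> \<open>The perturbed vector must have no zero on \<open>S0\<close>. Where \<theta>
    vanishes, \<epsilon> > 0 suffices; elsewhere a small \<epsilon> avoids the nonzero value to be
    excluded.\<close>
  have "\<forall>\<^sub>F \<epsilon> in at_right 0. \<epsilon> \<noteq> - \<theta> $ j" for j
    by (cases "\<theta> $ j = 0")
      (auto simp: eventually_at_filter intro!: eventually_mono[OF t1_space_nhds, of 0 "- \<theta> $ j"])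
  then have "\<forall>\<^sub>F \<epsilon> in at_right 0. \<forall>j\<in>S0. \<epsilon> \<noteq> - \<theta> $ j"
    using fin by (simp add: eventually_ball_finite_distrib)
  then have ev: "\<forall>\<^sub>F \<epsilon> in at_right 0. real n * ?\<rho> * (\<theta> \<bullet> \<theta> + 2 * (\<epsilon> * (h \<bullet> \<theta>)) + \<epsilon>\<^sup>2 * (h \<bullet> h))
      \<le> (X *\<^sub>v \<theta>) \<bullet> (X *\<^sub>v \<theta>) + 2 * (\<epsilon> * ((X *\<^sub>v h) \<bullet> (X *\<^sub>v \<theta>))) + \<epsilon>\<^sup>2 * ((X *\<^sub>v h) \<bullet> (X *\<^sub>v h))"
  proof eventually_elim
    case (elim \<epsilon>)
    let ?\<phi> = "\<theta> + \<epsilon> \<cdot>\<^sub>v h"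
    have c: "\<epsilon> \<cdot>\<^sub>v h \<in> carrier_vec p" "?\<phi> \<in> carrier_vec p" using \<theta> h by auto
    have "S0 \<subseteq> supp ?\<phi>" using S0 \<theta> elim by (fastforce simp: supp_def h_def)
    moreover have "supp ?\<phi> \<subseteq> S0 \<union> supp \<theta>" using \<theta> by (auto simp: supp_def h_def split: if_splits)
    then have "norm0 ?\<phi> \<le> m"
      unfolding norm0_def using card fin
      by (metis (no_types, lifting) card_mono finite_Un le_trans finite_nat_set_iff_bounded mem_Collect_eq supp_def)
    ultimately have "real n * ?\<rho> * (?\<phi> \<bullet> ?\<phi>) \<le> (X *\<^sub>v ?\<phi>) \<bullet> (X *\<^sub>v ?\<phi>)" using full c by blast
    moreover have "?\<phi> \<bullet> ?\<phi> = \<theta> \<bullet> \<theta> + 2 * (\<epsilon> * (h \<bullet> \<theta>)) + \<epsilon>\<^sup>2 * (h \<bullet> h)"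
      using \<theta> h by (subst scalar_prod_add_self[of _ p]) (auto simp: power2_eq_square)
    moreover have "X *\<^sub>v ?\<phi> = X *\<^sub>v \<theta> + \<epsilon> \<cdot>\<^sub>v (X *\<^sub>v h)"
      using X \<theta> h by (simp add: mult_add_distrib_mat_vec[of _ n p] mult_mat_vec[of _ n p])
    moreover have "(X *\<^sub>v \<theta> + \<epsilon> \<cdot>\<^sub>v (X *\<^sub>v h)) \<bullet> (X *\<^sub>v \<theta> + \<epsilon> \<cdot>\<^sub>v (X *\<^sub>v h))
      = (X *\<^sub>v \<theta>) \<bullet> (X *\<^sub>v \<theta>) + 2 * (\<epsilon> * ((X *\<^sub>v h) \<bullet> (X *\<^sub>v \<theta>))) + \<epsilon>\<^sup>2 * ((X *\<^sub>v h) \<bullet> (X *\<^sub>v h))"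
      using X \<theta> h by (subst scalar_prod_add_self[of _ n]) (auto simp: power2_eq_square)
    ultimately show ?case by simp
  qed
  show ?thesis
    by (rule tendsto_le[OF _ _ _ ev]) (auto intro!: tendsto_eq_intros)
qed

text \<open>Isolates what positivity of \<open>rho_sup\<close> yields: an eigenvalue bound for every
  vector whose support together with \<open>S0\<close> has at most \<open>m\<close> indices, whether
  or not that support contains \<open>S0\<close>. The case of interest is
  \<open>m = 2 * k\<close>.\<close>

locale restricted_eigenvalue =
  fixes X :: "real Matrix.mat" and n p m :: nat and S0 :: "nat set" and \<rho> :: real
  assumes X_mat: "X \<in> carrier_mat n p"
    and n_pos: "n > 0"
    and S0_sub: "S0 \<subseteq> {..<p}"
    and rho_pos: "\<rho> > 0"
    and RE: "\<And>\<theta>. \<theta> \<in> carrier_vec p \<Longrightarrow> card (S0 \<union> supp \<theta>) \<le> m \<Longrightarrow>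
      real n * \<rho> * (\<theta> \<bullet> \<theta>) \<le> (X *\<^sub>v \<theta>) \<bullet> (X *\<^sub>v \<theta>)"
begin

lemma card_le_mono: "A \<subseteq> B \<Longrightarrow> B \<subseteq> {..<p} \<Longrightarrow> card (S0 \<union> B) \<le> m \<Longrightarrow> card (S0 \<union> A) \<le> m"
  by (meson S0_sub Un_mono card_mono finite_lessThan finite_subset le_trans subset_refl Un_least)

lemma residual:
  assumes B: "B \<subseteq> {..<p}" "card (S0 \<union> B) \<le> m"
  shows "residual X n p B"
proof
  fix \<theta> assume \<theta>: "\<theta> \<in> carrier_vec p" "supp \<theta> \<subseteq> B" "X *\<^sub>v \<theta> = 0\<^sub>v n"
  have "real n * \<rho> * (\<theta> \<bullet> \<theta>) \<le> 0"
    using RE[OF \<theta>(1) card_le_mono[OF \<theta>(2) B]] \<theta>(3) by simp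
  then have "\<theta> \<bullet> \<theta> = 0"
    using n_pos rho_pos scalar_prod_self_nonneg[of \<theta>] by (simp add: mult_le_0_iff)
  then show "\<theta> = 0\<^sub>v p" using \<theta>(1) scalar_prod_self_eq_0 by blast
qed (use X_mat B in auto)

abbreviation resid_col :: "nat set \<Rightarrow> nat \<Rightarrow> real Matrix.vec" where
  "resid_col B j \<equiv> proj_perp X B *\<^sub>v col X j"

lemma resid_col_carrier:
  assumes "B \<subseteq> {..<p}" "card (S0 \<union> B) \<le> m" "j < p"
  shows "resid_col B j \<in> carrier_vec n"
proof -
  interpret residual X n p B using residual assms by blast
  show ?thesis using X_mat assms by (intro resid_carrier) auto
qed

text \<open>Here R (X \<theta>) = X (\<theta> - \<phi>) with \<phi> supported in \<open>B\<close>,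
  so \<theta> - \<phi> agrees with \<theta> off \<open>B\<close> and the eigenvalue bound applies to
  it. The right-hand side is |R (X \<theta>)|^2 expanded over columns, those in \<open>B\<close>
  contributing nothing.\<close>

lemma resid_lower_bound:
  assumes B: "B \<subseteq> {..<p}" and \<theta>: "\<theta> \<in> carrier_vec p" and card: "card (S0 \<union> (B \<union> supp \<theta>)) \<le> m"
  shows "real n * \<rho> * (\<Sum>j\<in>{..<p} - B. (\<theta> $ j)\<^sup>2)
    \<le> (\<Sum>j\<in>{..<p} - B. \<theta> $ j * (resid_col B j \<bullet> (X *\<^sub>v \<theta>)))"
proof -
  have supp\<theta>: "B \<union> supp \<theta> \<subseteq> {..<p}" using B \<theta> by (auto simp: supp_def)
  interpret residual X n p B
    using residual B card_le_mono[OF _ supp\<theta> card, of B] by blast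
  let ?u = "X *\<^sub>v \<theta>"
  have u: "?u \<in> carrier_vec n" using X_mat \<theta> by auto
  obtain \<phi> where \<phi>: "\<phi> \<in> carrier_vec p" "supp \<phi> \<subseteq> B" "?u = R ?u + X *\<^sub>v \<phi>"
    using resid_decomp[OF u] .
  have "X *\<^sub>v (\<theta> - \<phi>) = ?u - X *\<^sub>v \<phi>" using X_mat \<theta> \<phi> by (simp add: mult_minus_distrib_mat_vec[of _ n p])
  also have "\<dots> = R ?u"
  proof (rule eq_vecI)
    fix r assume "r < dim_vec (R ?u)"
    then have r: "r < n" using resid_carrier[OF u] by (metis carrier_vecD)
    have "?u $ r = (R ?u + X *\<^sub>v \<phi>) $ r" using \<phi>(3) by simp
    then show "(?u - X *\<^sub>v \<phi>) $ r = R ?u $ r"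
      using r X_mat by (simp del: index_mult_mat_vec)
  qed (use X_mat proj_perp_carrier in auto)
  finally have XR: "X *\<^sub>v (\<theta> - \<phi>) = R ?u" .
  have "supp (\<theta> - \<phi>) \<subseteq> B \<union> supp \<theta>" using \<theta> \<phi> by (auto simp: supp_def)
  then have "real n * \<rho> * ((\<theta> - \<phi>) \<bullet> (\<theta> - \<phi>)) \<le> R ?u \<bullet> R ?u"
    using RE[of "\<theta> - \<phi>"] card_le_mono[OF _ supp\<theta> card] \<theta> \<phi> unfolding XR by auto
  moreover have "(\<Sum>j\<in>{..<p} - B. (\<theta> $ j)\<^sup>2) \<le> (\<theta> - \<phi>) \<bullet> (\<theta> - \<phi>)"
  proof -
    have "(\<Sum>j\<in>{..<p} - B. (\<theta> $ j)\<^sup>2) = (\<Sum>j\<in>{..<p} - B. (\<theta> $ j - \<phi> $ j)\<^sup>2)"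
      using \<phi>(1,2) by (intro sum.cong) (auto simp: supp_def)
    also have "\<dots> \<le> (\<Sum>j<p. (\<theta> $ j - \<phi> $ j)\<^sup>2)" by (intro sum_mono2) auto
    also have "\<dots> = (\<theta> - \<phi>) \<bullet> (\<theta> - \<phi>)"
      using \<theta> \<phi> by (auto simp: scalar_prod_def lessThan_atLeast0 power2_eq_square intro!: sum.cong)
    finally show ?thesis .
  qed
  then have "real n * \<rho> * (\<Sum>j\<in>{..<p} - B. (\<theta> $ j)\<^sup>2) \<le> real n * \<rho> * ((\<theta> - \<phi>) \<bullet> (\<theta> - \<phi>))"
    using n_pos rho_pos by (intro mult_left_mono) auto
  moreover have "R ?u \<bullet> R ?u = (\<Sum>j\<in>{..<p} - B. \<theta> $ j * (R (col X j) \<bullet> ?u))"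
  proof -
    have "R ?u \<bullet> R ?u = R ?u \<bullet> ?u" using resid_scalar_prod u by simp
    also have "\<dots> = (\<Sum>j<p. \<theta> $ j * (R ?u \<bullet> col X j))"
      using scalar_prod_mult_mat_vec[OF X_mat resid_carrier[OF u] \<theta>] .
    also have "\<dots> = (\<Sum>j\<in>{..<p} - B. \<theta> $ j * (R ?u \<bullet> col X j))"
      using resid_col_0[OF u] by (intro sum.mono_neutral_right) auto
    also have "\<dots> = (\<Sum>j\<in>{..<p} - B. \<theta> $ j * (R (col X j) \<bullet> ?u))"
    proof (intro sum.cong refl)
      fix j assume "j \<in> {..<p} - B"
      then have x: "col X j \<in> carrier_vec n" using X_mat by auto
      show "\<theta> $ j * (R ?u \<bullet> col X j) = \<theta> $ j * (R (col X j) \<bullet> ?u)"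
        using resid_scalar_prod[OF u x] resid_scalar_prod[OF x u]
          comm_scalar_prod[OF resid_carrier[OF u] resid_carrier[OF x]] by simp
    qed
    finally show ?thesis .
  qed
  ultimately show ?thesis by linarith
qed

text \<open>The unit vector at \<open>j\<close> in \<open>resid_lower_bound\<close> even gives the
  lower bound n \<rho>. Positivity is what permits normalising residual columns.\<close>

lemma resid_col_sq_pos:
  assumes B: "B \<subseteq> {..<p}" and j: "j < p" "j \<notin> B" and card: "card (S0 \<union> insert j B) \<le> m"
  shows "0 < resid_col B j \<bullet> resid_col B j"
proof -
  interpret residual X n p B
    using residual B card_le_mono[OF _ _ card, of B] j B by blast
  let ?\<theta> = "unit_vec p j :: real Matrix.vec"
  have "supp ?\<theta> = {j}" using j by (auto simp: supp_def unit_vec_def split: if_splits)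
  then have "real n * \<rho> * (\<Sum>l\<in>{..<p} - B. (?\<theta> $ l)\<^sup>2)
    \<le> (\<Sum>l\<in>{..<p} - B. ?\<theta> $ l * (resid_col B l \<bullet> (X *\<^sub>v ?\<theta>)))"
    using card B by (intro resid_lower_bound) (auto simp: Un_commute)
  also have "(\<Sum>l\<in>{..<p} - B. ?\<theta> $ l * (resid_col B l \<bullet> (X *\<^sub>v ?\<theta>))) = resid_col B j \<bullet> (X *\<^sub>v ?\<theta>)"
    using j by (subst sum.remove[of _ j]) (auto intro!: sum.neutral)
  also have "\<dots> = resid_col B j \<bullet> resid_col B j"
    using mult_mat_unit_vec[OF X_mat j(1)] resid_scalar_prod[of "col X j" "col X j"] X_mat j by simp
  also have "(\<Sum>l\<in>{..<p} - B. (?\<theta> $ l)\<^sup>2) = 1"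
    using j by (subst sum.remove[of _ j]) (auto intro!: sum.neutral)
  finally show ?thesis using n_pos rho_pos by (smt (verit) mult_pos_pos mult.right_neutral of_nat_0_less_iff)
qed

text \<open>Pythagoras: projecting never lengthens a column.\<close>

lemma resid_col_sq_le:
  assumes B: "B \<subseteq> {..<p}" "card (S0 \<union> B) \<le> m" and j: "j < p"
  shows "resid_col B j \<bullet> resid_col B j \<le> col X j \<bullet> col X j"
proof -
  interpret residual X n p B using residual B by blast
  have x: "col X j \<in> carrier_vec n" using X_mat j by auto
  obtain \<theta> where \<theta>: "\<theta> \<in> carrier_vec p" "supp \<theta> \<subseteq> B" "col X j = R (col X j) + X *\<^sub>v \<theta>"
    using resid_decomp[OF x] .
  have "col X j \<bullet> col X j = (R (col X j) + X *\<^sub>v \<theta>) \<bullet> (R (col X j) + X *\<^sub>v \<theta>)" using \<theta>(3) by simp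
  also have "\<dots> = R (col X j) \<bullet> R (col X j) + 2 * ((X *\<^sub>v \<theta>) \<bullet> R (col X j)) + (X *\<^sub>v \<theta>) \<bullet> (X *\<^sub>v \<theta>)"
    using resid_carrier[OF x] X_mat \<theta> by (intro scalar_prod_add_self[of _ n]) auto
  finally show ?thesis using resid_orth[OF x \<theta>(1,2)] scalar_prod_self_nonneg[of "X *\<^sub>v \<theta>"] by simp
qed

end

section \<open>Regression coefficients behind gamma, and the gain of a swap\<close>

lemma mult_mat_index_sum:
  fixes A :: "real Matrix.mat"
  assumes "A \<in> carrier_mat a b" "C \<in> carrier_mat b d" "r < a" "s < d"
  shows "(A * C) $$ (r, s) = (\<Sum>c<b. A $$ (r, c) * C $$ (c, s))"
  using assms by (auto simp: scalar_prod_def lessThan_atLeast0 intro!: sum.cong)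

context restricted_eigenvalue
begin

lemma gamma_ratio_nonneg:
  assumes S: "S \<subseteq> {..<p}" "card (S0 \<union> S) \<le> m" and i: "i \<in> S"
  shows "0 \<le> gamma_ratio X S0 S i"
proof -
  interpret residual X n p "S - {i}"
    using residual[of "S - {i}"] card_le_mono[OF _ S, of "S - {i}"] S(1) by blast
  show ?thesis
    using i S Sig_index[of i i] by (auto simp: gamma_ratio_def Let_def scalar_prod_self_nonneg)
qed

text \<open>With T = S0 - S, \<open>a\<close> is the row vector whose l1-norm enters gamma: the
  least-squares coefficients of the residual of X_i on the residuals of the missing columns. The
  swap argument needs only its normal equations and its l1-norm, so the matrices disappear
  here.\<close>

lemma gamma_ratio_eq:
  assumes S: "S \<subseteq> {..<p}" "card (S0 \<union> S) \<le> m" and i: "i \<in> S - S0"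
  obtains a where
    "\<And>j. j \<in> S0 - S \<Longrightarrow> resid_col (S - {i}) i \<bullet> resid_col (S - {i}) j
      = (\<Sum>l\<in>S0 - S. a l * (resid_col (S - {i}) l \<bullet> resid_col (S - {i}) j))"
    "gamma_ratio X S0 S i = (\<Sum>l\<in>S0 - S. \<bar>a l\<bar>)\<^sup>2 / (resid_col (S - {i}) i \<bullet> resid_col (S - {i}) i / real n)"
proof -
  let ?B = "S - {i}"
  define T where "T = S0 - S"
  define d where "d = card T"
  have B: "?B \<subseteq> {..<p}" "card (S0 \<union> ?B) \<le> m" using S(1) card_le_mono[OF _ S, of "S - {i}"] by auto
  interpret residual X n p ?B using residual[OF B] .
  have ip: "i < p" using i S by auto
  have T: "T \<subseteq> {..<p}" "finite T" using S0_sub finite_subset unfolding T_def by blast+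
  have TB: "T \<inter> ?B = {}" by (auto simp: T_def)
  let ?R = "resid_col ?B"
  define G where "G = submatrix (Sig X ?B) T T"
  define H where "H = submatrix (Sig X ?B) {i} T"
  have pickT: "pick T c \<in> T" "pick T c < p" if "c < d" for c
    using that pick_in_set[of c T] T unfolding d_def by auto
  have surj: "T = pick T ` {..<d}"
    using bij_betw_imp_surj_on[OF bij_betw_pick[OF T(2)]] by (simp only: d_def)
  have pick_i: "pick {i} 0 = i" using pick_in_set[of 0 "{i}"] by (simp del: pick.simps)
  have G: "G \<in> carrier_mat d d" "\<And>r c. r < d \<Longrightarrow> c < d \<Longrightarrow> G $$ (r, c) = (?R (pick T r) \<bullet> ?R (pick T c)) / real n"
    unfolding G_def submatrix_eq[OF Sig_carrier T(1) T(1)] d_def[symmetric]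
    by (simp_all add: pickT Sig_index)
  have isub: "{i} \<subseteq> {..<p}" using ip by simp
  have H: "H \<in> carrier_mat 1 d" "\<And>c. c < d \<Longrightarrow> H $$ (0, c) = (?R i \<bullet> ?R (pick T c)) / real n"
    unfolding H_def d_def[symmetric] submatrix_eq[OF Sig_carrier isub T(1)]
    by (simp_all add: pickT Sig_index pick_i ip del: pick.simps)
  \<comment> \<open>Invertibility of \<open>G\<close>: a kernel vector pads to some \<theta> on
    \<open>T\<close> whose image is orthogonal to every residual column of \<open>T\<close>. By
    \<open>resid_lower_bound\<close> it vanishes off \<open>?B\<close>, and \<open>T\<close> lies
    off \<open>?B\<close>.\<close>
  have inj: "v = 0\<^sub>v d" if v: "v \<in> carrier_vec d" "G *\<^sub>v v = 0\<^sub>v d" for v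
  proof -
    obtain f where f: "v = vec d (\<lambda>c. f (pick T c))"
      using vec_eq_pick[OF v(1)[unfolded d_def]] unfolding d_def by metis
    let ?\<theta> = "vec p (\<lambda>j. if j \<in> T then f j else 0)"
    have th: "?\<theta> \<in> carrier_vec p" by simp
    have "?R l \<bullet> (X *\<^sub>v ?\<theta>) = 0" if l: "l \<in> T" for l
    proof -
      obtain r where r: "r < d" "pick T r = l" using subsetD[OF equalityD1[OF surj] l] by (auto simp del: pick.simps)
      have lp: "l < p" using l T by auto
      have "?R l \<bullet> (X *\<^sub>v ?\<theta>) = (\<Sum>j<p. ?\<theta> $ j * (?R l \<bullet> col X j))"
        using lp X_mat by (intro scalar_prod_mult_mat_vec[OF X_mat resid_col_carrier[OF B]]) auto
      also have "\<dots> = (\<Sum>j\<in>T. (?R l \<bullet> ?R j) * f j)"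
      proof (rule sum.mono_neutral_cong_right)
        fix j assume j: "j \<in> T"
        then have "j < p" using T by auto
        then have "?R l \<bullet> col X j = ?R l \<bullet> ?R j" using X_mat lp by (intro resid_scalar_prod) auto
        then show "?\<theta> $ j * (?R l \<bullet> col X j) = (?R l \<bullet> ?R j) * f j" using j \<open>j < p\<close> by simp
      qed (use T in auto)
      also have "\<dots> = (\<Sum>c<d. (?R l \<bullet> ?R (pick T c)) * f (pick T c))"
        unfolding d_def by (rule sum_pick[OF T(2), symmetric])
      also have "\<dots> = real n * (G *\<^sub>v v) $ r"
        using n_pos unfolding mult_mat_vec_index_sum[OF G(1) v(1) r(1)] sum_distrib_left
        by (intro sum.cong) (auto simp: G(2) r f)
      finally show ?thesis using v(2) r(1) by simp
    qed
    then have "(\<Sum>j\<in>{..<p} - ?B. ?\<theta> $ j * (?R j \<bullet> (X *\<^sub>v ?\<theta>))) = 0"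
      by (intro sum.neutral) auto
    moreover have "card (S0 \<union> (?B \<union> supp ?\<theta>)) \<le> m"
    proof -
      have "S0 \<union> (?B \<union> supp ?\<theta>) = S0 \<union> ?B" using supp_vec_if[of p T f] by (auto simp: T_def)
      then show ?thesis using B(2) by simp
    qed
    ultimately have "real n * \<rho> * (\<Sum>j\<in>{..<p} - ?B. (?\<theta> $ j)\<^sup>2) \<le> 0"
      using resid_lower_bound[OF B(1) th] by simp
    then have "(\<Sum>j\<in>{..<p} - ?B. (?\<theta> $ j)\<^sup>2) = 0"
      using n_pos rho_pos by (simp add: mult_le_0_iff) (meson antisym sum_nonneg zero_le_power2)
    then have z: "\<forall>j\<in>{..<p} - ?B. (?\<theta> $ j)\<^sup>2 = 0"
      by (subst (asm) sum_nonneg_eq_0_iff) auto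
    have "f j = 0" if "j \<in> T" for j
    proof -
      have j: "j \<in> {..<p} - ?B" using that T TB by auto
      then have "(?\<theta> $ j)\<^sup>2 = 0" using z by blast
      then show ?thesis using that j by simp
    qed
    then show ?thesis unfolding f by (intro eq_vecI) (auto simp: pickT)
  qed
  have I: "minv G \<in> carrier_mat d d" "minv G * G = 1\<^sub>m d"
    by (rule minv_inverse[OF G(1)], erule (1) inj)+
  define N where "N = H * minv G"
  have N: "N \<in> carrier_mat 1 d" using H(1) I(1) by (simp add: N_def)
  have "N * G = H * (minv G * G)" unfolding N_def by (rule assoc_mult_mat[OF H(1) I(1) G(1)])
  also have "\<dots> = H" unfolding I(2) by (rule right_mult_one_mat[OF H(1)])
  finally have NG: "N * G = H" .
  \<comment> \<open>The count inverts \<open>pick T\<close>, leading from indices back to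
    positions.\<close>
  define a where "a l = N $$ (0, card {x \<in> T. x < l})" for l
  have aN: "N $$ (0, c) = a (pick T c)" if "c < d" for c
    using that unfolding a_def d_def by (simp only: card_pick_le)
  show thesis
  proof (rule that[of a, folded T_def])
    fix j assume j: "j \<in> T"
    obtain s where s: "s < d" "pick T s = j" using subsetD[OF equalityD1[OF surj] j] by (auto simp del: pick.simps)
    have "?R i \<bullet> ?R j = real n * H $$ (0, s)" using H(2) s n_pos by simp
    also have "\<dots> = real n * (N * G) $$ (0, s)" using NG by simp
    also have "\<dots> = (\<Sum>c<d. a (pick T c) * (?R (pick T c) \<bullet> ?R j))"
      using n_pos s unfolding mult_mat_index_sum[OF N G(1) less_numeral_extra(1) s(1)] sum_distrib_left
      by (intro sum.cong) (auto simp: G(2) aN)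
    also have "\<dots> = (\<Sum>l\<in>T. a l * (?R l \<bullet> ?R j))"
      unfolding d_def by (rule sum_pick[OF T(2)])
    finally show "?R i \<bullet> ?R j = (\<Sum>l\<in>T. a l * (?R l \<bullet> ?R j))" .
  next
    have "norm1 (row N 0) = (\<Sum>c<d. \<bar>a (pick T c)\<bar>)"
      unfolding norm1_def using N by (intro sum.cong) (auto simp: aN simp del: pick.simps)
    also have "\<dots> = (\<Sum>l\<in>T. \<bar>a l\<bar>)" unfolding d_def by (rule sum_pick[OF T(2)])
    finally show "gamma_ratio X S0 S i = (\<Sum>l\<in>T. \<bar>a l\<bar>)\<^sup>2 / (?R i \<bullet> ?R i / real n)"
      using Sig_index[OF ip ip]
      by (simp add: gamma_ratio_def Let_def N_def H_def G_def T_def)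
  qed
qed

text \<open>Columns of the true support inside \<open>S - {i}\<close> are annihilated, and since
  \<open>i\<close> is outside \<open>S0\<close> only the missing columns carry signal.\<close>

lemma resid_signal:
  assumes S: "S \<subseteq> {..<p}" "card (S0 \<union> S) \<le> m" and i: "i \<in> S - S0"
    and \<beta>: "\<beta> \<in> carrier_vec p" "supp \<beta> = S0" and l: "l < p"
  shows "resid_col (S - {i}) l \<bullet> (X *\<^sub>v \<beta>)
    = (\<Sum>j\<in>S0 - S. \<beta> $ j * (resid_col (S - {i}) l \<bullet> resid_col (S - {i}) j))"
proof -
  let ?B = "S - {i}"
  let ?R = "resid_col ?B"
  have B: "?B \<subseteq> {..<p}" "card (S0 \<union> ?B) \<le> m" using S(1) card_le_mono[OF _ S, of "S - {i}"] by auto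
  interpret residual X n p ?B using residual[OF B] .
  have x: "col X j \<in> carrier_vec n" if "j < p" for j using X_mat that by auto
  have "?R l \<bullet> (X *\<^sub>v \<beta>) = (\<Sum>j<p. \<beta> $ j * (?R l \<bullet> col X j))"
    using resid_col_carrier[OF B l] \<beta>(1) by (intro scalar_prod_mult_mat_vec[OF X_mat]) auto
  also have "\<dots> = (\<Sum>j\<in>S0 - S. \<beta> $ j * (?R l \<bullet> ?R j))"
  proof (rule sum.mono_neutral_cong_right)
    show "\<forall>j\<in>{..<p} - (S0 - S). \<beta> $ j * (?R l \<bullet> col X j) = 0"
    proof
      fix j assume j: "j \<in> {..<p} - (S0 - S)"
      show "\<beta> $ j * (?R l \<bullet> col X j) = 0"
      proof (cases "j \<in> S0")
        case True
        then have "j \<in> ?B" using j i by auto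
        then show ?thesis using resid_col_0[OF x[OF l]] by simp
      next
        case False
        then show ?thesis using \<beta> j by (auto simp: supp_def)
      qed
    qed
    fix j assume "j \<in> S0 - S"
    then have "j < p" using S0_sub by auto
    then show "\<beta> $ j * (?R l \<bullet> col X j) = \<beta> $ j * (?R l \<bullet> ?R j)"
      using resid_scalar_prod[OF x[OF l] x] by simp
  qed (use S0_sub in auto)
  finally show ?thesis .
qed

text \<open>With T = S0 - S and z_l the inner products bounded by \<open>Z\<close>: n \<rho> b
  |\<beta>_T|_1 <= n \<rho> |\<beta>_T|_2^2 <= sum of \<beta>_l z_l <= Z |\<beta>_T|_1. The l1-norm
  cancels, so the size of T does not enter.\<close>

lemma signal_bound:
  assumes S: "S \<subseteq> {..<p}" "card (S0 \<union> S) \<le> m" and i: "i \<in> S - S0" and T: "S0 - S \<noteq> {}"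
    and \<beta>: "\<beta> \<in> carrier_vec p" "supp \<beta> = S0"
    and b: "b > 0" "\<And>j. j \<in> S0 \<Longrightarrow> b \<le> \<bar>\<beta> $ j\<bar>"
    and Z: "\<And>l. l \<in> S0 - S \<Longrightarrow> \<bar>resid_col (S - {i}) l \<bullet> (X *\<^sub>v \<beta>)\<bar> \<le> Z"
  shows "real n * \<rho> * b \<le> Z"
proof -
  let ?B = "S - {i}"
  let ?R = "resid_col ?B"
  have fin: "finite S0" using S0_sub finite_subset by blast
  have B: "?B \<subseteq> {..<p}" using S(1) by auto
  have eq: "S0 \<union> (?B \<union> supp \<beta>) = S0 \<union> ?B" using \<beta> by auto
  have "card (S0 \<union> (?B \<union> supp \<beta>)) \<le> m" unfolding eq using card_le_mono[OF _ S, of ?B] by auto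
  note lb = resid_lower_bound[OF B \<beta>(1) this]
  have out: "\<beta> $ j = 0" if "j \<in> {..<p} - ?B - (S0 - S)" for j
    using that i \<beta> by (auto simp: supp_def)
  have "real n * \<rho> * b * (\<Sum>j\<in>S0 - S. \<bar>\<beta> $ j\<bar>) = real n * \<rho> * (\<Sum>j\<in>S0 - S. \<bar>\<beta> $ j\<bar> * b)"
    by (simp add: sum_distrib_left sum_distrib_right mult_ac)
  also have "\<dots> \<le> real n * \<rho> * (\<Sum>j\<in>S0 - S. \<bar>\<beta> $ j\<bar> * \<bar>\<beta> $ j\<bar>)"
    using n_pos rho_pos b(2) by (intro mult_left_mono sum_mono) auto
  also have "(\<Sum>j\<in>S0 - S. \<bar>\<beta> $ j\<bar> * \<bar>\<beta> $ j\<bar>) = (\<Sum>j\<in>S0 - S. (\<beta> $ j)\<^sup>2)"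
    by (simp add: power2_eq_square abs_mult_self_eq)
  also have "\<dots> = (\<Sum>j\<in>{..<p} - ?B. (\<beta> $ j)\<^sup>2)"
    using out S0_sub by (intro sum.mono_neutral_left) auto
  also have "real n * \<rho> * \<dots> \<le> (\<Sum>j\<in>{..<p} - ?B. \<beta> $ j * (?R j \<bullet> (X *\<^sub>v \<beta>)))" by (rule lb)
  also have "\<dots> = (\<Sum>j\<in>S0 - S. \<beta> $ j * (?R j \<bullet> (X *\<^sub>v \<beta>)))"
    using out S0_sub by (intro sum.mono_neutral_right) auto
  also have "\<dots> \<le> (\<Sum>j\<in>S0 - S. \<bar>\<beta> $ j\<bar> * Z)"
  proof (rule sum_mono)
    fix j assume "j \<in> S0 - S"
    then have "\<bar>\<beta> $ j * (?R j \<bullet> (X *\<^sub>v \<beta>))\<bar> \<le> \<bar>\<beta> $ j\<bar> * Z"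
      using Z by (simp add: abs_mult mult_left_mono)
    then show "\<beta> $ j * (?R j \<bullet> (X *\<^sub>v \<beta>)) \<le> \<bar>\<beta> $ j\<bar> * Z" by linarith
  qed
  also have "\<dots> = Z * (\<Sum>j\<in>S0 - S. \<bar>\<beta> $ j\<bar>)" by (simp add: sum_distrib_left mult.commute)
  finally have "real n * \<rho> * b * (\<Sum>j\<in>S0 - S. \<bar>\<beta> $ j\<bar>) \<le> Z * (\<Sum>j\<in>S0 - S. \<bar>\<beta> $ j\<bar>)" .
  moreover have "0 < (\<Sum>j\<in>S0 - S. \<bar>\<beta> $ j\<bar>)"
    using b(1) T fin
    by (intro sum_pos) (auto intro: less_le_trans[OF b(1)] dest: b(2) simp del: zero_less_abs_iff)
  ultimately show ?thesis by simp
qed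

text \<open>The order of choice matters: \<open>j\<close>, \<open>e\<close> and \<open>f\<close> are
  obtained before \<open>w\<close>, hence are deterministic. \<open>e\<close> is the direction
  gained with the incoming column, \<open>f\<close> the one lost with the outgoing column
  \<open>i\<close>.\<close>

lemma swap_improves:
  assumes S: "S \<subseteq> {..<p}" "card (S0 \<union> S) \<le> m" and i: "i \<in> S - S0" and T: "S0 - S \<noteq> {}"
    and \<beta>: "\<beta> \<in> carrier_vec p" "supp \<beta> = S0"
    and b: "b > 0" "\<And>j. j \<in> S0 \<Longrightarrow> b \<le> \<bar>\<beta> $ j\<bar>"
    and cols: "\<And>j. j < p \<Longrightarrow> col X j \<bullet> col X j = real n"
    and \<gamma>: "gamma_ratio X S0 S i \<le> \<gamma>" "\<gamma> < 1"
  obtains j e f where "j \<in> S0 - S" "e \<in> carrier_vec n" "f \<in> carrier_vec n" "e \<bullet> e = 1" "f \<bullet> f = 1"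
    and "\<And>w. w \<in> carrier_vec n \<Longrightarrow> \<bar>e \<bullet> w\<bar> + \<bar>f \<bullet> w\<bar> < sqrt (real n) * \<rho> * b * (1 - sqrt \<gamma>) \<Longrightarrow>
      loss (X *\<^sub>v \<beta> + w) X ((S - {i}) \<union> {j}) < loss (X *\<^sub>v \<beta> + w) X S"
proof -
  let ?B = "S - {i}"
  let ?R = "resid_col ?B"
  let ?m = "X *\<^sub>v \<beta>"
  have B: "?B \<subseteq> {..<p}" "card (S0 \<union> ?B) \<le> m" using S(1) card_le_mono[OF _ S, of "S - {i}"] by auto
  interpret residual X n p ?B using residual[OF B] .
  have fin: "finite (S0 - S)" using S0_sub finite_subset by blast
  have ip: "i < p" using i S by auto
  define z where "z l = ?R l \<bullet> ?m" for l
  obtain j where j: "j \<in> S0 - S" "\<And>l. l \<in> S0 - S \<Longrightarrow> \<bar>z l\<bar> \<le> \<bar>z j\<bar>"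
  proof -
    have "Max ((\<lambda>l. \<bar>z l\<bar>) ` (S0 - S)) \<in> (\<lambda>l. \<bar>z l\<bar>) ` (S0 - S)" using fin T by (intro Max_in) auto
    then obtain j where "j \<in> S0 - S" "Max ((\<lambda>l. \<bar>z l\<bar>) ` (S0 - S)) = \<bar>z j\<bar>" by auto
    then show thesis using that[of j] Max_ge fin by (metis (no_types, lifting) finite_imageI image_eqI)
  qed
  have jp: "j < p" using j S0_sub by auto
  have zlow: "real n * \<rho> * b \<le> \<bar>z j\<bar>"
    using j(2) by (intro signal_bound[OF S i T \<beta> b]) (auto simp: z_def)
  obtain a where a: "\<And>j. j \<in> S0 - S \<Longrightarrow> ?R i \<bullet> ?R j = (\<Sum>l\<in>S0 - S. a l * (?R l \<bullet> ?R j))"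
    and ratio: "gamma_ratio X S0 S i = (\<Sum>l\<in>S0 - S. \<bar>a l\<bar>)\<^sup>2 / (?R i \<bullet> ?R i / real n)"
    using gamma_ratio_eq[OF S i] by blast
  let ?A = "\<Sum>l\<in>S0 - S. \<bar>a l\<bar>"
  define Di where "Di = ?R i \<bullet> ?R i"
  define Dj where "Dj = ?R j \<bullet> ?R j"
  \<comment> \<open>By the normal equations the correlation of the outgoing column is the
    \<open>a\<close>-weighted combination of those of the missing columns, so |z i| is at most the
    l1-norm of \<open>a\<close> times |z j|.\<close>
  have "z i = (\<Sum>j\<in>S0 - S. \<beta> $ j * (\<Sum>l\<in>S0 - S. a l * (?R l \<bullet> ?R j)))"
    unfolding z_def resid_signal[OF S i \<beta> ip] using a by simp
  also have "\<dots> = (\<Sum>l\<in>S0 - S. a l * (\<Sum>j\<in>S0 - S. \<beta> $ j * (?R l \<bullet> ?R j)))"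
    unfolding sum_distrib_left by (subst sum.swap) (simp add: mult_ac)
  also have "\<dots> = (\<Sum>l\<in>S0 - S. a l * z l)"
    unfolding z_def using resid_signal[OF S i \<beta>] S0_sub by (intro sum.cong) auto
  finally have zi: "z i = (\<Sum>l\<in>S0 - S. a l * z l)" .
  have "\<bar>z i\<bar> \<le> (\<Sum>l\<in>S0 - S. \<bar>a l * z l\<bar>)" unfolding zi by (rule sum_abs)
  also have "\<dots> \<le> (\<Sum>l\<in>S0 - S. \<bar>a l\<bar> * \<bar>z j\<bar>)"
    using j(2) by (intro sum_mono) (simp add: abs_mult mult_left_mono)
  finally have zi_le: "\<bar>z i\<bar> \<le> ?A * \<bar>z j\<bar>" by (simp add: sum_distrib_right)
  have Di: "0 < Di" unfolding Di_def using S i ip by (intro resid_col_sq_pos[OF B(1)]) (auto simp: insert_absorb)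
  have Dj: "0 < Dj" unfolding Dj_def using B(2) j jp
    by (intro resid_col_sq_pos[OF B(1)]) (auto simp: insert_absorb)
  have Djn: "Dj \<le> real n" unfolding Dj_def using resid_col_sq_le[OF B jp] cols[OF jp] by simp
  have xi: "col X i \<in> carrier_vec n" and xj: "col X j \<in> carrier_vec n" using X_mat ip jp by auto
  have Ri: "?R i \<in> carrier_vec n" and Rj: "?R j \<in> carrier_vec n" using resid_col_carrier[OF B] ip jp by auto
  define e where "e = (1 / sqrt Dj) \<cdot>\<^sub>v ?R j"
  define f where "f = (1 / sqrt Di) \<cdot>\<^sub>v ?R i"
  have ec: "e \<in> carrier_vec n" and fc: "f \<in> carrier_vec n" using Ri Rj by (auto simp: e_def f_def)
  have e1: "e \<bullet> e = 1" using Dj Rj by (simp add: e_def Dj_def[symmetric])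
  have f1: "f \<bullet> f = 1" using Di Ri by (simp add: f_def Di_def[symmetric])
  have m: "?m \<in> carrier_vec n" using X_mat \<beta> by auto
  show thesis
  proof (rule that[OF j(1) ec fc e1 f1])
    fix w assume w: "w \<in> carrier_vec n"
      and small: "\<bar>e \<bullet> w\<bar> + \<bar>f \<bullet> w\<bar> < sqrt (real n) * \<rho> * b * (1 - sqrt \<gamma>)"
    let ?y = "?m + w"
    have y: "?y \<in> carrier_vec n" using m w by auto
    have sn: "sqrt (real n) > 0" using n_pos by simp
    have split: "v \<bullet> ?y = v \<bullet> ?m + v \<bullet> w" if "v \<in> carrier_vec n" for v
      using that m w by (intro scalar_prod_add_distrib) auto
    have ey: "e \<bullet> ?y = z j / sqrt Dj + e \<bullet> w"
      unfolding split[OF ec] using Rj m by (simp add: e_def z_def)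
    have fy: "f \<bullet> ?y = z i / sqrt Di + f \<bullet> w"
      unfolding split[OF fc] using Ri m by (simp add: f_def z_def)
    \<comment> \<open>The root of the ratio is the l1-norm of \<open>a\<close> divided by the length
      of the outgoing residual in units of sqrt n. It bounds the normalised correlation of
      \<open>i\<close> by sqrt gamma |z j| / sqrt n.\<close>
    have "?A\<^sup>2 / (Di / real n) \<le> \<gamma>" using \<gamma> ratio by (simp add: Di_def)
    then have "sqrt (?A\<^sup>2 / (Di / real n)) \<le> sqrt \<gamma>" by (rule real_sqrt_le_mono)
    also have "sqrt (?A\<^sup>2 / (Di / real n)) = ?A * sqrt (real n) / sqrt Di"
      by (simp add: real_sqrt_divide real_sqrt_mult sum_nonneg)
    finally have "?A * sqrt (real n) / sqrt Di \<le> sqrt \<gamma>" .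
    then have A: "?A / sqrt Di \<le> sqrt \<gamma> / sqrt (real n)" using sn by (simp add: pos_le_divide_eq)
    have "\<bar>z i / sqrt Di\<bar> = \<bar>z i\<bar> / sqrt Di" using Di by simp
    also have "\<dots> \<le> ?A * \<bar>z j\<bar> / sqrt Di" using zi_le Di by (intro divide_right_mono) auto
    also have "\<dots> = (?A / sqrt Di) * \<bar>z j\<bar>" by simp
    also have "\<dots> \<le> (sqrt \<gamma> / sqrt (real n)) * \<bar>z j\<bar>" using A by (intro mult_right_mono) auto
    finally have I: "\<bar>z i / sqrt Di\<bar> \<le> sqrt \<gamma> * (\<bar>z j\<bar> / sqrt (real n))" by simp
    \<comment> \<open>The full column has squared norm n and its residual is no longer, so
      normalising by \<open>sqrt Dj\<close> instead of sqrt n can only help.\<close>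
    have J: "\<bar>z j / sqrt Dj\<bar> \<ge> \<bar>z j\<bar> / sqrt (real n)"
      using Dj Djn by (simp add: divide_left_mono)
    have "sqrt (real n) * \<rho> * b = real n * \<rho> * b / sqrt (real n)"
      using sn by (simp add: field_simps)
    also have "\<dots> \<le> \<bar>z j\<bar> / sqrt (real n)" using zlow sn by (intro divide_right_mono) auto
    finally have "sqrt (real n) * \<rho> * b * (1 - sqrt \<gamma>) \<le> \<bar>z j\<bar> / sqrt (real n) * (1 - sqrt \<gamma>)"
      using \<gamma>(2) by (intro mult_right_mono) auto
    also have "\<dots> = \<bar>z j\<bar> / sqrt (real n) - sqrt \<gamma> * (\<bar>z j\<bar> / sqrt (real n))"
      by (subst mult.commute) (simp only: left_diff_distrib mult_1_left)
    finally have "\<bar>f \<bullet> ?y\<bar> < \<bar>e \<bullet> ?y\<bar>"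
      using small I J unfolding ey fy by linarith
    then have "(f \<bullet> ?y)\<^sup>2 < (e \<bullet> ?y)\<^sup>2"
      using power_strict_mono[of "\<bar>f \<bullet> ?y\<bar>" "\<bar>e \<bullet> ?y\<bar>" 2] by simp
    moreover have "(f \<bullet> ?y)\<^sup>2 = (?R i \<bullet> ?y)\<^sup>2 / Di" "(e \<bullet> ?y)\<^sup>2 = (?R j \<bullet> ?y)\<^sup>2 / Dj"
      using Ri Rj y Di Dj by (simp_all add: e_def f_def power_divide)
    moreover have "loss ?y X (insert i ?B) = R ?y \<bullet> R ?y - (?R i \<bullet> ?y)\<^sup>2 / Di"
      unfolding Di_def using Di ip y by (intro loss_insert) (auto simp: Di_def)
    moreover have "loss ?y X (insert j ?B) = R ?y \<bullet> R ?y - (?R j \<bullet> ?y)\<^sup>2 / Dj"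
      unfolding Dj_def using Dj jp y j by (intro loss_insert) (auto simp: Dj_def)
    moreover have "insert i ?B = S" using i by auto
    ultimately show "loss ?y X (?B \<union> {j}) < loss ?y X S" by simp
  qed
qed

end

section \<open>Noise and the union bound\<close>

text \<open>Every run ends with the \<open>stop\<close> rule, whose premise is local optimality, and
  each swap preserves size and range.\<close>

lemma swap_run_local_min:
  assumes "swap_run p L S T" "S \<subseteq> {..<p}"
  shows "T \<subseteq> {..<p} \<and> card T = card S \<and> (\<forall>i\<in>T. \<forall>i'\<in>{..<p} - T. L T \<le> L ((T - {i}) \<union> {i'}))"
  using assms
proof (induction rule: swap_run.induct)
  case (swap S i i' T)
  have i: "i \<in> S" "i' \<in> {..<p} - S" using swap.hyps(1) by (auto simp: is_arg_min_def)
  have "finite S" using swap.prems finite_subset by blast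
  then have "card ((S - {i}) \<union> {i'}) = card S" using i card.remove[of S i] by simp
  then show ?case using swap.IH swap.prems i by auto
qed auto

text \<open>Converts decay in \<open>p choose k\<close> into decay in \<open>p\<close>, uniformly in
  \<open>k\<close>.\<close>

lemma le_binomial:
  assumes "1 \<le> k" "k < p"
  shows "p \<le> p choose k"
  using assms
proof (induction p arbitrary: k)
  case (Suc p)
  then obtain k' where k: "k = Suc k'" by (cases k) auto
  show ?case
  proof (cases "k = p")
    case True
    then show ?thesis using binomial_symmetric[of p "Suc p"] by simp
  next
    case False
    then have "p \<le> p choose k" "1 \<le> p choose k'" using Suc k by (auto simp: Suc_le_eq)
    then show ?thesis unfolding k by simp
  qed
qed simp

text \<open>Here \<open>c\<close> stands for the product of c and sigma. With s = sqrt gamma and 1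
  <= 1 / sqrt \<rho>, negativity of g gives 2 c^2 < (1 + s) (1 - s - 2 c), and 1 + s <= 2 turns this
  into 1 - s > 2 c + c^2. The quadratic term of g is thus the source of the factor 1 + c /
  2.\<close>

lemma swap_g_neg_imp:
  assumes "swap_g \<gamma> \<rho> c < 0" "0 \<le> \<gamma>" "0 < \<rho>" "\<rho> \<le> 1" "0 < c"
  shows "\<gamma> < 1" "2 * c * (1 + c / 2) \<le> 1 - sqrt \<gamma>"
proof -
  define s where "s = sqrt \<gamma>"
  have s: "0 \<le> s" "\<gamma> = s\<^sup>2" using assms by (auto simp: s_def)
  have "1 \<le> 1 / sqrt \<rho>" using assms by (simp add: real_le_rsqrt)
  then have "c * (s + 1) \<le> c * (s + 1 / sqrt \<rho>)" using assms by (intro mult_left_mono) auto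
  then have *: "s\<^sup>2 - 1 + 2 * (c * (s + 1)) + 2 * c\<^sup>2 < 0"
    using assms(1) unfolding swap_g_def s_def[symmetric] s(2)
    by (simp add: mult.assoc s(1))
  have cs: "0 \<le> c * (s + 1)" using s assms by simp
  then have "s\<^sup>2 < 1" using * by (smt (verit) zero_le_power2)
  then show "\<gamma> < 1" by (simp add: s)
  have s1: "s < 1" using \<open>s\<^sup>2 < 1\<close> s(1) by (simp add: power_less_one_iff)
  have "2 * c\<^sup>2 < (1 + s) * (1 - s - 2 * c)"
    using * by (simp add: power2_eq_square algebra_simps)
  moreover have "(1 + s) * (1 - s - 2 * c) \<le> 2 * (1 - s - 2 * c)"
  proof (rule mult_right_mono)
    show "0 \<le> 1 - s - 2 * c"
      using calculation s(1) by (smt (verit) mult_nonneg_nonpos zero_le_power2)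
  qed (use s1 in auto)
  ultimately show "2 * c * (1 + c / 2) \<le> 1 - sqrt \<gamma>"
    unfolding s_def[symmetric] by (simp add: algebra_simps power2_eq_square)
qed

section \<open>Sub-Gaussian tails of linear forms in the noise\<close>

context sparse_linear_model
begin

lemma noise_measurable:
  assumes "u \<in> carrier_vec n"
  shows "(\<lambda>\<omega>. u \<bullet> w \<omega>) \<in> borel_measurable M"
proof -
  have [measurable]: "(\<lambda>\<omega>. w \<omega> $ i) \<in> borel_measurable M" if "i < n" for i
    using indep that by (auto simp: indep_vars_def)
  have "(\<lambda>\<omega>. \<Sum>i<n. u $ i * w \<omega> $ i) \<in> borel_measurable M" by (intro borel_measurable_sum) auto
  then show ?thesis
    using w_carrier by (subst measurable_cong[where g = "\<lambda>\<omega>. \<Sum>i<n. u $ i * w \<omega> $ i"])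
      (auto simp: scalar_prod_def lessThan_atLeast0 carrier_vecD[OF w_carrier])
qed

text \<open>Independence factorises the exponential moment, and the variance proxies of the
  coordinates add up to that of the linear form.\<close>

lemma noise_mgf:
  assumes u: "u \<in> carrier_vec n"
  shows "integrable M (\<lambda>\<omega>. exp (s * (u \<bullet> w \<omega>)))"
    and "expectation (\<lambda>\<omega>. exp (s * (u \<bullet> w \<omega>))) \<le> exp (s\<^sup>2 * (u \<bullet> u) * \<sigma>\<^sup>2 / 2)"
proof -
  let ?Y = "\<lambda>i \<omega>. exp ((s * u $ i) * w \<omega> $ i)"
  have eq: "exp (s * (u \<bullet> w \<omega>)) = (\<Prod>i<n. ?Y i \<omega>)" if "\<omega> \<in> space M" for \<omega>
    using w_carrier[OF that]
    by (simp add: scalar_prod_def lessThan_atLeast0 sum_distrib_left mult.assoc flip: exp_sum)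
  have ind: "indep_vars (\<lambda>_. borel) ?Y {..<n}"
    by (rule indep_vars_compose2[OF indep]) simp
  have int: "integrable M (?Y i)" if "i < n" for i
    using sub_gauss[OF that] by (auto simp: subgaussian_def)
  have "integrable M (\<lambda>\<omega>. \<Prod>i<n. ?Y i \<omega>)" using ind int by (intro indep_vars_integrable) auto
  then show "integrable M (\<lambda>\<omega>. exp (s * (u \<bullet> w \<omega>)))"
    by (subst Bochner_Integration.integrable_cong[OF refl eq])
  have "expectation (\<lambda>\<omega>. exp (s * (u \<bullet> w \<omega>))) = expectation (\<lambda>\<omega>. \<Prod>i<n. ?Y i \<omega>)"
    by (rule Bochner_Integration.integral_cong[OF refl eq])
  also have "\<dots> = (\<Prod>i<n. expectation (?Y i))" using ind int by (intro indep_vars_lebesgue_integral) auto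
  also have "\<dots> \<le> (\<Prod>i<n. exp ((s * u $ i)\<^sup>2 * \<sigma>\<^sup>2 / 2))"
    using sub_gauss by (intro prod_mono) (auto simp: subgaussian_def)
  also have "\<dots> = exp (\<Sum>i<n. (s * u $ i)\<^sup>2 * \<sigma>\<^sup>2 / 2)" by (rule exp_sum[symmetric]) simp
  also have "(\<Sum>i<n. (s * u $ i)\<^sup>2 * \<sigma>\<^sup>2 / 2) = s\<^sup>2 * (u \<bullet> u) * \<sigma>\<^sup>2 / 2"
    using u by (simp add: scalar_prod_def lessThan_atLeast0 sum_distrib_left sum_distrib_right
        sum_divide_distrib power_mult_distrib power2_eq_square mult_ac)
  finally show "expectation (\<lambda>\<omega>. exp (s * (u \<bullet> w \<omega>))) \<le> exp (s\<^sup>2 * (u \<bullet> u) * \<sigma>\<^sup>2 / 2)" .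
qed

lemma noise_tail:
  assumes u: "u \<in> carrier_vec n" "u \<bullet> u \<le> V" and pos: "V > 0" "\<sigma> > 0" "\<tau> \<ge> 0"
  shows "prob {\<omega> \<in> space M. \<tau> \<le> u \<bullet> w \<omega>} \<le> exp (- (\<tau>\<^sup>2 / (2 * \<sigma>\<^sup>2 * V)))"
proof -
  \<comment> \<open>Minimises the Chernoff exponent s^2 V \<sigma>^2 / 2 - s \<tau>.\<close>
  define s where "s = \<tau> / (\<sigma>\<^sup>2 * V)"
  have s: "s \<ge> 0" using pos by (simp add: s_def)
  have "{\<omega> \<in> space M. \<tau> \<le> u \<bullet> w \<omega>} \<subseteq> {\<omega> \<in> space M. exp (s * \<tau>) \<le> exp (s * (u \<bullet> w \<omega>))}"
    using s by (auto intro: mult_left_mono)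
  moreover have "{\<omega> \<in> space M. exp (s * \<tau>) \<le> exp (s * (u \<bullet> w \<omega>))} \<in> events"
    using noise_measurable[OF u(1)] by measurable
  ultimately have "prob {\<omega> \<in> space M. \<tau> \<le> u \<bullet> w \<omega>} \<le> prob {\<omega> \<in> space M. exp (s * \<tau>) \<le> exp (s * (u \<bullet> w \<omega>))}"
    by (rule finite_measure_mono)
  also have "\<dots> \<le> expectation (\<lambda>\<omega>. exp (s * (u \<bullet> w \<omega>))) / exp (s * \<tau>)"
    by (rule integral_Markov_inequality_measure[OF noise_mgf(1)[OF u(1)] sets.top]) auto
  also have "\<dots> \<le> exp (s\<^sup>2 * (u \<bullet> u) * \<sigma>\<^sup>2 / 2) / exp (s * \<tau>)"
    by (intro divide_right_mono noise_mgf(2)[OF u(1)]) simp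
  also have "\<dots> \<le> exp (s\<^sup>2 * V * \<sigma>\<^sup>2 / 2) / exp (s * \<tau>)"
    using u(2) by (intro divide_right_mono) (auto intro!: mult_left_mono mult_right_mono divide_right_mono)
  also have "\<dots> = exp (s\<^sup>2 * V * \<sigma>\<^sup>2 / 2 - s * \<tau>)" by (simp add: exp_diff)
  also have "s\<^sup>2 * V * \<sigma>\<^sup>2 / 2 - s * \<tau> = - (\<tau>\<^sup>2 / (2 * \<sigma>\<^sup>2 * V))"
    using pos by (simp add: s_def field_simps power2_eq_square)
  finally show ?thesis .
qed

text \<open>A sum of two absolute values is the largest of four signed sums, which gives the factor
  4. Each is a linear form with vector of squared norm at most 4, orthogonal or not, and V = 4 in
  \<open>noise_tail\<close> gives the 8.\<close>

lemma noise_pair_tail: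
  assumes e: "e \<in> carrier_vec n" "e \<bullet> e = 1" and f: "f \<in> carrier_vec n" "f \<bullet> f = 1"
    and pos: "\<sigma> > 0" "\<tau> \<ge> 0"
  shows "{\<omega> \<in> space M. \<tau> \<le> \<bar>e \<bullet> w \<omega>\<bar> + \<bar>f \<bullet> w \<omega>\<bar>} \<in> events"
    and "prob {\<omega> \<in> space M. \<tau> \<le> \<bar>e \<bullet> w \<omega>\<bar> + \<bar>f \<bullet> w \<omega>\<bar>} \<le> 4 * exp (- (\<tau>\<^sup>2 / (8 * \<sigma>\<^sup>2)))"
proof -
  note [measurable] = noise_measurable[OF e(1)] noise_measurable[OF f(1)]
  show "{\<omega> \<in> space M. \<tau> \<le> \<bar>e \<bullet> w \<omega>\<bar> + \<bar>f \<bullet> w \<omega>\<bar>} \<in> events" by measurable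
  define A where "A q = {\<omega> \<in> space M. \<tau> \<le> (fst q \<cdot>\<^sub>v e + snd q \<cdot>\<^sub>v f) \<bullet> w \<omega>}" for q :: "real \<times> real"
  let ?Q = "{1, -1} \<times> {1, -1} :: (real \<times> real) set"
  have lin: "(a \<cdot>\<^sub>v e + b \<cdot>\<^sub>v f) \<bullet> v = a * (e \<bullet> v) + b * (f \<bullet> v)" if "v \<in> carrier_vec n" for a b v
    using e f that by (simp add: add_scalar_prod_distrib[of _ n])
  have A_eq: "A q = {\<omega> \<in> space M. \<tau> \<le> fst q * (e \<bullet> w \<omega>) + snd q * (f \<bullet> w \<omega>)}" for q
    unfolding A_def using lin[OF w_carrier] by auto
  have Aq: "A q \<in> events \<and> prob (A q) \<le> exp (- (\<tau>\<^sup>2 / (8 * \<sigma>\<^sup>2)))" if q: "q \<in> ?Q" for q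
  proof -
    let ?u = "fst q \<cdot>\<^sub>v e + snd q \<cdot>\<^sub>v f"
    have u: "?u \<in> carrier_vec n" using e f by auto
    \<comment> \<open>Nonnegativity of |q1 e - q2 f|^2 bounds the cross term of |q1 e + q2
      f|^2.\<close>
    have "0 \<le> (fst q \<cdot>\<^sub>v e - snd q \<cdot>\<^sub>v f) \<bullet> (fst q \<cdot>\<^sub>v e - snd q \<cdot>\<^sub>v f)" by (rule scalar_prod_self_nonneg)
    also have "\<dots> = (fst q)\<^sup>2 * (e \<bullet> e) - 2 * snd q * (f \<bullet> (fst q \<cdot>\<^sub>v e)) + (snd q)\<^sup>2 * (f \<bullet> f)"
      using e(1) f(1) by (subst scalar_prod_minus_smult_self[of _ n]) (auto simp: power2_eq_square)
    finally have ge: "2 * fst q * snd q * (f \<bullet> e) \<le> (fst q)\<^sup>2 + (snd q)\<^sup>2"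
      using e f by (simp add: mult_ac)
    have "?u \<bullet> ?u = (fst q)\<^sup>2 * (e \<bullet> e) + 2 * fst q * snd q * (f \<bullet> e) + (snd q)\<^sup>2 * (f \<bullet> f)"
      using e(1) f(1) by (subst scalar_prod_add_self[of _ n]) (auto simp: power2_eq_square)
    also have "\<dots> \<le> 4" using ge e f q by auto
    finally have "?u \<bullet> ?u \<le> 4" .
    from noise_tail[OF u this _ pos] show ?thesis
      using noise_measurable[OF u] unfolding A_def by (auto simp: mult_ac)
  qed
  have "{\<omega> \<in> space M. \<tau> \<le> \<bar>e \<bullet> w \<omega>\<bar> + \<bar>f \<bullet> w \<omega>\<bar>} \<subseteq> (\<Union>q\<in>?Q. A q)"
    unfolding A_eq by (auto simp: abs_if split: if_splits)
  then have "prob {\<omega> \<in> space M. \<tau> \<le> \<bar>e \<bullet> w \<omega>\<bar> + \<bar>f \<bullet> w \<omega>\<bar>} \<le> prob (\<Union>q\<in>?Q. A q)"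
    using Aq by (intro finite_measure_mono sets.finite_UN) blast+
  also have "\<dots> \<le> (\<Sum>q\<in>?Q. prob (A q))"
    using Aq by (intro finite_measure_subadditive_finite) auto
  also have "\<dots> \<le> (\<Sum>q\<in>?Q. exp (- (\<tau>\<^sup>2 / (8 * \<sigma>\<^sup>2))))" using Aq by (intro sum_mono) blast
  also have "\<dots> = 4 * exp (- (\<tau>\<^sup>2 / (8 * \<sigma>\<^sup>2)))" by (simp add: card_cartesian_product)
  finally show "prob {\<omega> \<in> space M. \<tau> \<le> \<bar>e \<bullet> w \<omega>\<bar> + \<bar>f \<bullet> w \<omega>\<bar>} \<le> 4 * exp (- (\<tau>\<^sup>2 / (8 * \<sigma>\<^sup>2)))" .
qed


section \<open>The failure event of one wrong support\<close>

lemma col_scalar_prod_self: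
  assumes "j < p" "0 < n"
  shows "col X j \<bullet> col X j = real n"
  using col_norm[OF assms(1)] assms(2) by (simp add: norm2_sq field_simps)

lemma supp_beta: "supp \<beta> \<subseteq> {..<p}" "finite (supp \<beta>)"
proof -
  show "supp \<beta> \<subseteq> {..<p}" using beta_carrier by (auto simp: supp_def)
  then show "finite (supp \<beta>)" using finite_subset by blast
qed

lemma beta_min_le: "j \<in> supp \<beta> \<Longrightarrow> beta_min \<beta> \<le> \<bar>\<beta> $ j\<bar>"
  unfolding beta_min_def using supp_beta(2) by (intro Min_le) auto

lemma beta_min_pos:
  assumes "0 < k"
  shows "0 < beta_min \<beta>"
proof -
  have "supp \<beta> \<noteq> {}" using sparse assms by auto
  then have "beta_min \<beta> \<in> (\<lambda>i. \<bar>\<beta> $ i\<bar>) ` supp \<beta>"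
    unfolding beta_min_def using supp_beta(2) by (intro Min_in) auto
  then show ?thesis by (auto simp: supp_def)
qed

text \<open>At the unit vector of a true index the quotient is 1, because columns are normalised.
  This supplies the bound on \<rho> required by \<open>swap_g_neg_imp\<close>.\<close>

lemma rho_cap_le_1:
  assumes "0 < k" "0 < n"
  shows "rho_cap X (supp \<beta>) k 1 \<le> 1"
proof -
  obtain j where j: "j \<in> supp \<beta>" using sparse assms by fastforce
  then have jp: "j < p" using supp_beta by auto
  let ?\<theta> = "unit_vec p j :: real Matrix.vec"
  have supp: "supp ?\<theta> = {j}" using jp by (auto simp: supp_def unit_vec_def split: if_splits)
  have "(norm2 (X *\<^sub>v ?\<theta>))\<^sup>2 / (real (dim_row X) * (norm2 ?\<theta>)\<^sup>2) = 1"
    using mult_mat_unit_vec[OF X_carrier jp] col_scalar_prod_self[OF jp assms(2)] X_carrier jp assms(2)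
    by (simp add: norm2_sq)
  moreover have "?\<theta> \<in> carrier_vec (dim_col X)" "norm0 ?\<theta> \<le> k" "1 \<le> card (supp \<beta> \<inter> supp ?\<theta>)"
    using X_carrier supp j assms by (auto simp: norm0_def)
  ultimately have "1 \<in> {(norm2 (X *\<^sub>v \<theta>))\<^sup>2 / (real (dim_row X) * (norm2 \<theta>)\<^sup>2) | \<theta>.
       \<theta> \<in> carrier_vec (dim_col X) \<and> norm0 \<theta> \<le> k \<and> card (supp \<beta> \<inter> supp \<theta>) \<ge> 1}"
    by (metis (mono_tags, lifting) mem_Collect_eq)
  then show ?thesis unfolding rho_cap_def
    by (rule cInf_lower) (auto intro!: bdd_belowI[of _ 0])
qed

context
  assumes n_pos: "0 < n" and rho_pos: "0 < rho_sup X (supp \<beta>) (2 * k)"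
begin

interpretation restricted_eigenvalue X n p "2 * k" "supp \<beta>" "rho_sup X (supp \<beta>) (2 * k)"
  using X_carrier n_pos supp_beta(1) rho_pos
  by unfold_locales (auto intro: restricted_eigenvalue_of_rho_sup)

lemma card_support_union:
  assumes "S \<subseteq> {..<p}" "card S = k"
  shows "card (supp \<beta> \<union> S) \<le> 2 * k"
  using card_Un_le[of "supp \<beta>" S] assms sparse by simp

lemma support_diff_nonempty:
  assumes "S \<subseteq> {..<p}" "card S = k" "S \<noteq> supp \<beta>"
  shows "S - supp \<beta> \<noteq> {}" "supp \<beta> - S \<noteq> {}"
  using assms sparse supp_beta(2) finite_subset[OF assms(1)] by (auto dest: card_subset_eq)

text \<open>For d = k the family \<open>Omega\<close> contains every support of size k, so
  \<open>S\<close> takes part in the maximum; \<open>i\<close> is where its inner minimum is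
  attained.\<close>

lemma gamma_d_bound:
  assumes S: "S \<subseteq> {..<p}" "card S = k" "S \<noteq> supp \<beta>"
  obtains i where "i \<in> S - supp \<beta>" "gamma_ratio X (supp \<beta>) S i \<le> gamma_d X (supp \<beta>) k k"
    "0 \<le> gamma_d X (supp \<beta>) k k"
proof -
  let ?r = "gamma_ratio X (supp \<beta>)"
  have fin: "finite (S - supp \<beta>)" using S(1) finite_subset by blast
  have "(MIN i\<in>S - supp \<beta>. ?r S i) \<in> ?r S ` (S - supp \<beta>)"
    using fin support_diff_nonempty[OF S] by (intro Min_in) auto
  then obtain i where i: "i \<in> S - supp \<beta>" "(MIN i\<in>S - supp \<beta>. ?r S i) = ?r S i" by auto
  have "Omega (dim_col X) (supp \<beta>) k k \<subseteq> Pow {..<p}" using X_carrier by (auto simp: Omega_def)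
  then have "finite (Omega (dim_col X) (supp \<beta>) k k)" by (rule finite_subset) auto
  moreover have "S \<in> Omega (dim_col X) (supp \<beta>) k k - {supp \<beta>}" using S X_carrier by (auto simp: Omega_def)
  ultimately have "?r S i \<le> gamma_d X (supp \<beta>) k k"
    unfolding gamma_d_def i(2)[symmetric] by (intro Max_ge) auto
  moreover have "0 \<le> ?r S i"
    using gamma_ratio_nonneg[OF S(1) card_support_union[OF S(1,2)]] i(1) by auto
  ultimately show thesis using that[OF i(1)] by simp
qed

text \<open>\<open>E\<close> is described by two linear forms of the noise, hence measurable, and
  merely contains the outcomes where \<open>S\<close> admits no improving swap. As \<tau> is the
  same for all \<open>S\<close>, the union bound has one common term.\<close>

lemma failure_event:
  assumes S: "S \<subseteq> {..<p}" "card S = k" "S \<noteq> supp \<beta>"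
    and \<sigma>: "0 < \<sigma>" and k: "0 < k" and \<gamma>: "gamma_d X (supp \<beta>) k k < 1"
  defines "\<tau> \<equiv> sqrt (real n) * rho_sup X (supp \<beta>) (2 * k) * beta_min \<beta> * (1 - sqrt (gamma_d X (supp \<beta>) k k))"
  shows "\<exists>E\<in>events. prob E \<le> 4 * exp (- (\<tau>\<^sup>2 / (8 * \<sigma>\<^sup>2))) \<and> (\<forall>\<omega>\<in>space M - E. \<exists>i\<in>S. \<exists>j\<in>{..<p} - S.
    loss (X *\<^sub>v \<beta> + w \<omega>) X ((S - {i}) \<union> {j}) < loss (X *\<^sub>v \<beta> + w \<omega>) X S)"
proof -
  obtain i where i: "i \<in> S - supp \<beta>" "gamma_ratio X (supp \<beta>) S i \<le> gamma_d X (supp \<beta>) k k"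
    using gamma_d_bound[OF S] by blast
  obtain j e f where j: "j \<in> supp \<beta> - S"
    and ef: "e \<in> carrier_vec n" "f \<in> carrier_vec n" "e \<bullet> e = 1" "f \<bullet> f = 1"
    and imp: "\<And>w. w \<in> carrier_vec n \<Longrightarrow> \<bar>e \<bullet> w\<bar> + \<bar>f \<bullet> w\<bar> < \<tau> \<Longrightarrow>
      loss (X *\<^sub>v \<beta> + w) X ((S - {i}) \<union> {j}) < loss (X *\<^sub>v \<beta> + w) X S"
    by (rule swap_improves[OF S(1) card_support_union[OF S(1,2)] i(1) support_diff_nonempty(2)[OF S]
          beta_carrier refl beta_min_pos[OF k] beta_min_le col_scalar_prod_self[OF _ n_pos] i(2) \<gamma>,
          folded \<tau>_def]) blast+
  have "0 \<le> \<tau>"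
    unfolding \<tau>_def using rho_pos beta_min_pos[OF k] \<gamma> by (intro mult_nonneg_nonneg) auto
  note tail = noise_pair_tail[OF ef(1,3,2,4) \<sigma> this]
  show ?thesis
  proof (rule bexI, intro conjI ballI, rule tail(2))
    fix \<omega> assume \<omega>: "\<omega> \<in> space M - {\<omega> \<in> space M. \<tau> \<le> \<bar>e \<bullet> w \<omega>\<bar> + \<bar>f \<bullet> w \<omega>\<bar>}"
    then have "loss (X *\<^sub>v \<beta> + w \<omega>) X ((S - {i}) \<union> {j}) < loss (X *\<^sub>v \<beta> + w \<omega>) X S"
      using imp w_carrier by auto
    moreover have "i \<in> S" "j \<in> {..<p} - S" using i j supp_beta by auto
    ultimately show "\<exists>i\<in>S. \<exists>j\<in>{..<p} - S.
      loss (X *\<^sub>v \<beta> + w \<omega>) X ((S - {i}) \<union> {j}) < loss (X *\<^sub>v \<beta> + w \<omega>) X S" by blast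
  qed (rule tail(1))
qed

end

text \<open>A quantitative form for one fixed dimension. \<open>S1\<close> and \<open>Shat\<close>
  may depend on the noise, since off the union of all failure events no wrong support of size k is a
  local minimum.\<close>

lemma swap_recovery:
  assumes \<sigma>: "0 < \<sigma>" and c: "0 < c"
    and y: "\<forall>\<omega>\<in>space M. y \<omega> = X *\<^sub>v \<beta> + w \<omega>"
    and rho_2k: "0 < rho_sup X (supp \<beta>) (2 * k)" and rho_k1: "0 < rho_cap X (supp \<beta>) k 1"
    and init: "\<forall>\<omega>\<in>space M. S1 \<omega> \<subseteq> {..<p} \<and> card (S1 \<omega>) = k \<and> card (supp \<beta> - S1 \<omega>) > 1"
    and out: "\<forall>\<omega>\<in>space M. swap_run p (loss (y \<omega>) X) (S1 \<omega>) (Shat \<omega>)"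
    and out_rv: "Shat \<in> measurable M (count_space UNIV)"
    and g: "swap_g (gamma_d X (supp \<beta>) k k) (rho_cap X (supp \<beta>) k 1) (c * \<sigma>) < 0"
    and n_large: "real n > 2 * ln (real (p choose k))
      / (c\<^sup>2 * (beta_min \<beta>)\<^sup>2 * (rho_sup X (supp \<beta>) (2 * k))\<^sup>2)"
  shows "1 - 4 * real p powr (- (c * \<sigma>)) \<le> prob {\<omega> \<in> space M. Shat \<omega> = supp \<beta>}"
proof -
  \<comment> \<open>\<open>init\<close> holds at every outcome, so one outcome suffices to extract
    the deterministic facts 0 < k < p and 0 < n.\<close>
  obtain \<omega>0 where \<omega>0: "\<omega>0 \<in> space M" using not_empty by blast
  let ?S1 = "S1 \<omega>0"
  have S1: "?S1 \<subseteq> {..<p}" "card ?S1 = k" "card (supp \<beta> - ?S1) > 1" using init \<omega>0 by auto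
  have "card (supp \<beta> - ?S1) \<le> k" using sparse card_mono[OF supp_beta(2), of "supp \<beta> - ?S1"] by auto
  then have k: "0 < k" and n: "0 < n" using S1(3) k_le_n by auto
  have S1_ne: "?S1 \<noteq> supp \<beta>" using S1(3) by auto
  have "supp \<beta> - ?S1 \<noteq> {}" using S1(3) by (metis card.empty not_less_zero)
  then have "?S1 \<subset> {..<p}" using S1(1) supp_beta(1) by auto
  then have kp: "k < p" using psubset_card_mono[of "{..<p}" ?S1] S1(2) by simp
  let ?\<gamma> = "gamma_d X (supp \<beta>) k k" and ?\<rho> = "rho_sup X (supp \<beta>) (2 * k)" and ?b = "beta_min \<beta>"
  have "0 \<le> ?\<gamma>" using gamma_d_bound[OF n rho_2k S1(1,2) S1_ne] by blast
  note gg = swap_g_neg_imp[OF g this rho_k1 rho_cap_le_1[OF k n] mult_pos_pos[OF c \<sigma>]]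
  define C where "C = real (p choose k)"
  have Cp: "real p \<le> C" unfolding C_def using le_binomial[of k p] k kp by simp
  have p1: "1 \<le> real p" using kp by simp
  have b: "0 < ?b" by (rule beta_min_pos[OF k])
  define \<tau> where "\<tau> = sqrt (real n) * ?\<rho> * ?b * (1 - sqrt ?\<gamma>)"
  define \<epsilon> where "\<epsilon> = 4 * exp (- (\<tau>\<^sup>2 / (8 * \<sigma>\<^sup>2)))"
  define \<S> where "\<S> = {S. S \<subseteq> {..<p} \<and> card S = k} - {supp \<beta>}"
  have fin: "finite \<S>" unfolding \<S>_def by (rule finite_Diff, rule finite_subset[of _ "Pow {..<p}"]) auto
  have "\<forall>S\<in>\<S>. \<exists>E. E \<in> events \<and> prob E \<le> \<epsilon> \<and> (\<forall>\<omega>\<in>space M - E. \<exists>i\<in>S. \<exists>j\<in>{..<p} - S.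
      loss (X *\<^sub>v \<beta> + w \<omega>) X ((S - {i}) \<union> {j}) < loss (X *\<^sub>v \<beta> + w \<omega>) X S)"
  proof
    fix S assume "S \<in> \<S>"
    then have "S \<subseteq> {..<p}" "card S = k" "S \<noteq> supp \<beta>" by (auto simp: \<S>_def)
    from failure_event[OF n rho_2k this \<sigma> k gg(1), unfolded Bex_def]
    show "\<exists>E. E \<in> events \<and> prob E \<le> \<epsilon> \<and> (\<forall>\<omega>\<in>space M - E. \<exists>i\<in>S. \<exists>j\<in>{..<p} - S.
      loss (X *\<^sub>v \<beta> + w \<omega>) X ((S - {i}) \<union> {j}) < loss (X *\<^sub>v \<beta> + w \<omega>) X S)"
      unfolding \<epsilon>_def \<tau>_def Bex_def .
  qed
  from bchoice[OF this] obtain E where E: "\<And>S. S \<in> \<S> \<Longrightarrow> E S \<in> events" "\<And>S. S \<in> \<S> \<Longrightarrow> prob (E S) \<le> \<epsilon>"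
    "\<And>S \<omega>. S \<in> \<S> \<Longrightarrow> \<omega> \<in> space M - E S \<Longrightarrow> \<exists>i\<in>S. \<exists>j\<in>{..<p} - S.
      loss (X *\<^sub>v \<beta> + w \<omega>) X ((S - {i}) \<union> {j}) < loss (X *\<^sub>v \<beta> + w \<omega>) X S"
    by blast
  let ?U = "\<Union>S\<in>\<S>. E S"
  have U: "?U \<in> events" using fin E(1) by auto
  have good: "{\<omega> \<in> space M. Shat \<omega> = supp \<beta>} \<in> events"
    using out_rv by measurable
  have "space M - ?U \<subseteq> {\<omega> \<in> space M. Shat \<omega> = supp \<beta>}"
  proof
    fix \<omega> assume \<omega>: "\<omega> \<in> space M - ?U"
    have run: "swap_run p (loss (X *\<^sub>v \<beta> + w \<omega>) X) (S1 \<omega>) (Shat \<omega>)" "S1 \<omega> \<subseteq> {..<p}" "card (S1 \<omega>) = k"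
      using out y init \<omega> by auto
    note min = swap_run_local_min[OF run(1,2)]
    have "Shat \<omega> \<notin> \<S>"
    proof
      assume "Shat \<omega> \<in> \<S>"
      from E(3)[OF this, of \<omega>] \<omega> this min show False by (fastforce simp: not_less[symmetric])
    qed
    then show "\<omega> \<in> {\<omega> \<in> space M. Shat \<omega> = supp \<beta>}" using min run(3) \<omega> by (auto simp: \<S>_def)
  qed
  then have "prob (space M - ?U) \<le> prob {\<omega> \<in> space M. Shat \<omega> = supp \<beta>}"
    using good by (rule finite_measure_mono)
  moreover have "prob (space M - ?U) = 1 - prob ?U" using U by (rule prob_compl)
  moreover have "prob ?U \<le> 4 * real p powr (- (c * \<sigma>))"
  proof -
    have "prob ?U \<le> (\<Sum>S\<in>\<S>. prob (E S))"
      using fin E(1) by (intro finite_measure_subadditive_finite) auto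
    also have "\<dots> \<le> (\<Sum>S\<in>\<S>. \<epsilon>)" using E(2) by (rule sum_mono)
    also have "\<dots> = real (card \<S>) * \<epsilon>" by simp
    also have "\<dots> \<le> C * \<epsilon>"
    proof (rule mult_right_mono)
      have "card \<S> \<le> card {S. S \<subseteq> {..<p} \<and> card S = k}"
        unfolding \<S>_def by (rule card_mono[OF finite_subset[of _ "Pow {..<p}"]]) auto
      then show "real (card \<S>) \<le> C" using n_subsets[of "{..<p}" k] by (simp add: C_def)
    qed (simp add: \<epsilon>_def)
    also have "\<dots> \<le> 4 * exp (- (c * \<sigma> * ln C))"
    proof -
      have C: "0 < C" "0 \<le> ln C" using Cp p1 by auto
      let ?s = "c * \<sigma>"
      have s: "0 < ?s" using c \<sigma> by simp
      have "2 * ln C < real n * (c\<^sup>2 * ?b\<^sup>2 * ?\<rho>\<^sup>2)"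
        using n_large c b rho_2k unfolding C_def by (simp add: pos_divide_less_eq)
      then have lnC: "ln C \<le> real n * (c\<^sup>2 * ?b\<^sup>2 * ?\<rho>\<^sup>2) / 2" by simp
      \<comment> \<open>In 1 + ?s the 1 pays for the number of events, at most \<open>C\<close>, and
        ?s remains as the exponent of decay.\<close>
      have "ln C * (1 + ?s) \<le> ln C * (1 + ?s / 2)\<^sup>2"
        using C zero_le_power2[of ?s]
        by (intro mult_left_mono) (auto simp: power2_eq_square algebra_simps)
      also have "\<dots> \<le> real n * (c\<^sup>2 * ?b\<^sup>2 * ?\<rho>\<^sup>2) / 2 * (1 + ?s / 2)\<^sup>2"
        using lnC by (intro mult_right_mono) auto
      \<comment> \<open>The constants match here: c^2 / 2 = (2 c \<sigma>)^2 / (8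
        \<sigma>^2).\<close>
      also have "\<dots> = real n * ?\<rho>\<^sup>2 * ?b\<^sup>2 * (2 * ?s * (1 + ?s / 2))\<^sup>2 / (8 * \<sigma>\<^sup>2)"
        using \<sigma> by (simp add: power2_eq_square field_simps)
      also have "\<dots> \<le> real n * ?\<rho>\<^sup>2 * ?b\<^sup>2 * (1 - sqrt ?\<gamma>)\<^sup>2 / (8 * \<sigma>\<^sup>2)"
        using gg(2) s by (intro divide_right_mono mult_left_mono power_mono) auto
      also have "\<dots> = \<tau>\<^sup>2 / (8 * \<sigma>\<^sup>2)" by (simp add: \<tau>_def power_mult_distrib)
      finally have "\<epsilon> \<le> 4 * exp (- (ln C * (1 + ?s)))" by (simp add: \<epsilon>_def)
      then have "C * \<epsilon> \<le> exp (ln C) * (4 * exp (- (ln C * (1 + ?s))))"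
        using C by (simp add: mult_left_mono)
      also have "\<dots> = 4 * (exp (ln C) * exp (- (ln C * (1 + ?s))))" by simp
      also have "\<dots> = 4 * exp (- (?s * ln C))"
        unfolding exp_add[symmetric] by (simp add: algebra_simps)
      finally show ?thesis .
    qed
    also have "\<dots> \<le> 4 * exp (- (c * \<sigma> * ln (real p)))"
      using Cp p1 c \<sigma> by simp
    also have "\<dots> = 4 * real p powr (- (c * \<sigma>))" using p1 by (simp add: powr_def)
    finally show ?thesis .
  qed
  ultimately show ?thesis by linarith
qed

end

theorem theorem4:
  fixes M :: "nat \<Rightarrow> 'a measure"
    and n k :: "nat \<Rightarrow> nat"
    and X :: "nat \<Rightarrow> real Matrix.mat"
    and \<beta> :: "nat \<Rightarrow> real Matrix.vec"
    and w :: "nat \<Rightarrow> 'a \<Rightarrow> real Matrix.vec"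
    and y :: "nat \<Rightarrow> 'a \<Rightarrow> real Matrix.vec"
    and S1 Shat :: "nat \<Rightarrow> 'a \<Rightarrow> nat set"
    and \<sigma> c :: real
  assumes sigma_pos: "0 < \<sigma>"
    and model: "\<forall>\<^sub>F p in sequentially.
      sparse_linear_model (M p) (n p) p (k p) (X p) (\<beta> p) (w p) \<sigma>"
    and y_eq: "\<forall>\<^sub>F p in sequentially. \<forall>\<omega>\<in>space (M p). y p \<omega> = X p *\<^sub>v \<beta> p + w p \<omega>"
    and rho_2k: "\<forall>\<^sub>F p in sequentially. rho_sup (X p) (supp (\<beta> p)) (2 * k p) > 0"
    and rho_k1: "\<forall>\<^sub>F p in sequentially. rho_cap (X p) (supp (\<beta> p)) (k p) 1 > 0"
    and init: "\<forall>\<^sub>F p in sequentially. \<forall>\<omega>\<in>space (M p).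
      S1 p \<omega> \<subseteq> {..<p} \<and> card (S1 p \<omega>) = k p \<and> card (supp (\<beta> p) - S1 p \<omega>) > 1"
    and out: "\<forall>\<^sub>F p in sequentially. \<forall>\<omega>\<in>space (M p).
      swap_run p (loss (y p \<omega>) (X p)) (S1 p \<omega>) (Shat p \<omega>)"
    and out_rv: "\<forall>\<^sub>F p in sequentially. Shat p \<in> measurable (M p) (count_space UNIV)"
    and c: "0 < c" "c\<^sup>2 < 1 / (18 * \<sigma>\<^sup>2)"
    and g_neg: "\<forall>\<^sub>F p in sequentially.
      swap_g (gamma_d (X p) (supp (\<beta> p)) (k p) (k p)) (rho_cap (X p) (supp (\<beta> p)) (k p) 1) (c * \<sigma>) < 0"
    and binom: "\<forall>\<^sub>F p in sequentially.
      ln (real (p choose k p)) > 4 + ln (real ((k p)\<^sup>2 * (p - k p)))"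
    and n_large: "\<forall>\<^sub>F p in sequentially.
      real (n p) > 2 * ln (real (p choose k p))
        / (c\<^sup>2 * (beta_min (\<beta> p))\<^sup>2 * (rho_sup (X p) (supp (\<beta> p)) (2 * k p))\<^sup>2)"
  shows "(\<lambda>p. measure (M p) {\<omega> \<in> space (M p). Shat p \<omega> = supp (\<beta> p)}) \<longlonglongrightarrow> 1"
proof (rule tendsto_sandwich)
  show "\<forall>\<^sub>F p in sequentially. 1 - 4 * real p powr (- (c * \<sigma>))
      \<le> measure (M p) {\<omega> \<in> space (M p). Shat p \<omega> = supp (\<beta> p)}"
    using model y_eq rho_2k rho_k1 init out out_rv g_neg n_large
  proof eventually_elim
    case (elim p)
    interpret sparse_linear_model "M p" "n p" p "k p" "X p" "\<beta> p" "w p" \<sigma> by (rule elim(1))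
    show ?case by (rule swap_recovery[OF sigma_pos c(1) elim(2-9)])
  qed
  show "\<forall>\<^sub>F p in sequentially. measure (M p) {\<omega> \<in> space (M p). Shat p \<omega> = supp (\<beta> p)} \<le> 1"
    using model
  proof eventually_elim
    case (elim p)
    interpret sparse_linear_model "M p" "n p" p "k p" "X p" "\<beta> p" "w p" \<sigma> by (rule elim)
    show ?case by (rule prob_le_1)
  qed
  \<comment> \<open>The exponent is the same negative number for every \<open>p\<close>, so the
    bound vanishes however \<open>n\<close> and \<open>k\<close> grow.\<close>
  have "(\<lambda>p. real p powr (- (c * \<sigma>))) \<longlonglongrightarrow> 0"
    using sigma_pos c(1) by (intro tendsto_neg_powr filterlim_real_sequentially) simp
  from tendsto_diff[OF tendsto_const tendsto_mult_left[OF this], of 1 4]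
  show "(\<lambda>p. 1 - 4 * real p powr (- (c * \<sigma>))) \<longlonglongrightarrow> 1"
    by simp
qed simp

end
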